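(* Consider Gaussian nonparametric regression: for each $n$ one observes $Y^{(n)}=(Y_1,\dots,Y_n)$ with $Y_i$ independent $N(f(x_i),1)$ for fixed inputs $x_i\in[0,1]^d$, and likelihood $q_n(f,Y^{(n)})=\prod_{i=1}^n\phi(Y_i-f(x_i))$ ($\phi$ the standard normal density); write $P^{(n)}_f$ for this distribution. Let $\mathcal{F}^\star$ be a set of measurable functions $[0,1]^d\to\mathbb{R}$. For each $n$ let $\mathcal{M}_n\subset\mathbb{N}_{\ge2}\times\mathbb{N}$ be a set of depth-width pairs with $|\mathcal{M}_n|\lesssim n^\iota$ for some constant $\iota>0$ and $\max_{(K,M)\in\mathcal{M}_n}(K\vee M)\lesssim n$, and let $1\le B_n\lesssim n^\nu$ for some $\nu>0$. Then the adaptive variational posterior $\widehat\Xi_n$ over neural networks defined below satisfies, for any sequence $A_n\to\infty$, $$\sup_{f^\star\in\mathcal{F}^\star}P^{(n)}_{f^\star}\Big[\widehat\Xi_n\big(\|\mathrm{net}(\theta)-f^\star\|_{n,2}\ge A_n\epsilon_n(\mathcal{F}^\star)\big)\Big]\to0,$$ where $$\epsilon_n(\mathcal{F}^\star):=\inf_{(K,M)\in\mathcal{M}_n}\Big\{\sup_{f^*\in\mathcal{F}^\star}\inf_{\theta\in\Theta^{\le B_n}_{(K,M)}}\|\mathrm{net}(\theta)-f^*\|_\infty+KM\sqrt{\tfrac{\log n}{n}}\Big\}.$$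
   Context: Neural networks: for $K\ge2$, $M\ge1$, $\Theta_{(K,M)}$ is the set of tuples $\theta=((W_k,b_k))_{k\in[K]}$ with $W_k\in\mathbb{R}^{M_{k+1}\times M_k}$, $b_k\in\mathbb{R}^{M_{k+1}}$, where $M_1=d$, $M_2=\dots=M_K=M$, $M_{K+1}=1$; $p_{(K,M)}$ is its dimension; $\mathrm{net}(\theta)(x)=[W_K,b_K]\circ\mathrm{ReLU}\circ[W_{K-1},b_{K-1}]\circ\cdots\circ\mathrm{ReLU}\circ[W_1,b_1]x$ with $[W,b]x=Wx+b$ and elementwise $\mathrm{ReLU}(x)=\max(x,0)$. $\Theta^{\le B}_{(K,M)}=\{\theta\in\Theta_{(K,M)}:|\theta|_\infty\le B\}$ (max absolute entry). Prior: $\Pi_n=\sum_{(K,M)\in\mathcal{M}_n}\alpha_{n,(K,M)}\Pi_{n,(K,M)}$, $\Pi_{n,(K,M)}=\bigotimes_{j=1}^{p_{(K,M)}}\mathrm{Unif}(-B_n,B_n)$ on $\Theta^{\le B_n}_{(K,M)}$, $\alpha_{n,(K,M)}\propto e^{-b_0(KM)^2\log n}$ for a fixed $b_0>0$. Variational family for each $(K,M)$: $\mathbb{V}_{n,(K,M)}=\{\bigotimes_{j=1}^{p_{(K,M)}}\mathrm{Unif}(\psi_{1,j},\psi_{2,j}):-B_n\le\psi_{1,j}<\psi_{2,j}\le B_n\}$. Variational posterior: $\widehat\Xi_n=\sum_{(K,M)}\widehat\gamma_{n,(K,M)}\widehat\Xi_{n,(K,M)}$ with $\widehat\Xi_{n,(K,M)}\in\operatorname{argmin}_{\Xi\in\mathbb{V}_{n,(K,M)}}\mathcal{E}(\Xi,\Pi_{n,(K,M)})$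 and $\widehat\gamma_{n,(K,M)}\propto\alpha_{n,(K,M)}e^{-\mathcal{E}(\widehat\Xi_{n,(K,M)},\Pi_{n,(K,M)})}$, where $\mathcal{E}(\Xi,\Pi)=-\int\log q_n(\mathrm{net}(\theta),Y^{(n)})d\Xi(\theta)+\mathrm{KL}(\Xi,\Pi)$. Empirical norm: $\|g\|_{n,2}=(\frac1n\sum_{i=1}^ng(x_i)^2)^{1/2}$; $\|g\|_\infty=\sup_{x\in[0,1]^d}|g(x)|$. *)

theory Defs
  imports "HOL-Probability.Probability"
begin

(* Inputs/points of [0,1]^d are represented as functions nat => real; only the
   coordinates 0..d-1 are relevant. *)
definition cube :: "nat \<Rightarrow> (nat \<Rightarrow> real) set" where
  "cube d = {x. \<forall>j<d. 0 \<le> x j \<and> x j \<le> 1}"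

(* layer widths M_1 = d, M_2 = ... = M_K = M, M_{K+1} = 1 (0-indexed: k = 0..K) *)
definition lw :: "nat \<Rightarrow> nat \<Rightarrow> nat \<Rightarrow> nat \<Rightarrow> nat" where
  "lw d K M k = (if k = 0 then d else if k = K then 1 else M)"

(* offset of the parameters of layer k (0-indexed) in the parameter vector *)
definition poff :: "nat \<Rightarrow> nat \<Rightarrow> nat \<Rightarrow> nat \<Rightarrow> nat" where
  "poff d K M k = (\<Sum>j<k. lw d K M (Suc j) * (lw d K M j + 1))"

definition pdim :: "nat \<Rightarrow> nat \<Rightarrow> nat \<Rightarrow> nat" where
  "pdim d K M = poff d K M K"

definition Wt :: "nat \<Rightarrow> nat \<Rightarrow> nat \<Rightarrow> (nat \<Rightarrow> real) \<Rightarrow> nat \<Rightarrow> nat \<Rightarrow> nat \<Rightarrow> real" where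
  "Wt d K M \<theta> k i j = \<theta> (poff d K M k + i * (lw d K M k + 1) + j)"

definition bt :: "nat \<Rightarrow> nat \<Rightarrow> nat \<Rightarrow> (nat \<Rightarrow> real) \<Rightarrow> nat \<Rightarrow> nat \<Rightarrow> real" where
  "bt d K M \<theta> k i = \<theta> (poff d K M k + i * (lw d K M k + 1) + lw d K M k)"

definition aff :: "nat \<Rightarrow> nat \<Rightarrow> nat \<Rightarrow> (nat \<Rightarrow> real) \<Rightarrow> nat \<Rightarrow> (nat \<Rightarrow> real) \<Rightarrow> nat \<Rightarrow> real" where
  "aff d K M \<theta> k v = (\<lambda>i. (\<Sum>j<lw d K M k. Wt d K M \<theta> k i j * v j) + bt d K M \<theta> k i)"

primrec hid :: "nat \<Rightarrow> nat \<Rightarrow> nat \<Rightarrow> (nat \<Rightarrow> real) \<Rightarrow> nat \<Rightarrow> (nat \<Rightarrow> real) \<Rightarrow> nat \<Rightarrow> real" where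
  "hid d K M \<theta> 0 x = x"
| "hid d K M \<theta> (Suc k) x = (\<lambda>i. max (aff d K M \<theta> k (hid d K M \<theta> k x) i) 0)"

definition net :: "nat \<Rightarrow> nat \<Rightarrow> nat \<Rightarrow> (nat \<Rightarrow> real) \<Rightarrow> (nat \<Rightarrow> real) \<Rightarrow> real" where
  "net d K M \<theta> x = aff d K M \<theta> (K - 1) (hid d K M \<theta> (K - 1) x) 0"

definition ThetaB :: "nat \<Rightarrow> nat \<Rightarrow> nat \<Rightarrow> real \<Rightarrow> (nat \<Rightarrow> real) set" where
  "ThetaB d K M B = PiE {..<pdim d K M} (\<lambda>_. {-B..B})"

definition supnorm :: "nat \<Rightarrow> ((nat \<Rightarrow> real) \<Rightarrow> real) \<Rightarrow> ereal" where
  "supnorm d g = (SUP x\<in>cube d. ereal \<bar>g x\<bar>)"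

definition empnorm :: "(nat \<Rightarrow> (nat \<Rightarrow> real)) \<Rightarrow> nat \<Rightarrow> ((nat \<Rightarrow> real) \<Rightarrow> real) \<Rightarrow> real" where
  "empnorm xs n g = sqrt ((1 / real n) * (\<Sum>i\<in>{1..n}. (g (xs i))\<^sup>2))"

definition Pdata :: "(nat \<Rightarrow> (nat \<Rightarrow> real)) \<Rightarrow> nat \<Rightarrow> ((nat \<Rightarrow> real) \<Rightarrow> real) \<Rightarrow> (nat \<Rightarrow> real) measure" where
  "Pdata xs n f = PiM {1..n} (\<lambda>i. density lborel (normal_density (f (xs i)) 1))"

definition lik :: "(nat \<Rightarrow> (nat \<Rightarrow> real)) \<Rightarrow> nat \<Rightarrow> ((nat \<Rightarrow> real) \<Rightarrow> real) \<Rightarrow> (nat \<Rightarrow> real) \<Rightarrow> real" where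
  "lik xs n f Y = (\<Prod>i\<in>{1..n}. std_normal_density (Y i - f (xs i)))"

definition unif_prod :: "nat \<Rightarrow> (nat \<Rightarrow> real) \<Rightarrow> (nat \<Rightarrow> real) \<Rightarrow> (nat \<Rightarrow> real) measure" where
  "unif_prod p a b = PiM {..<p} (\<lambda>j. uniform_measure lborel {a j..b j})"

definition prior_KM :: "nat \<Rightarrow> nat \<Rightarrow> nat \<Rightarrow> real \<Rightarrow> (nat \<Rightarrow> real) measure" where
  "prior_KM d K M B = unif_prod (pdim d K M) (\<lambda>_. -B) (\<lambda>_. B)"

definition Vfam :: "nat \<Rightarrow> nat \<Rightarrow> nat \<Rightarrow> real \<Rightarrow> (nat \<Rightarrow> real) measure set" where
  "Vfam d K M B = {unif_prod (pdim d K M) a b | a b.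
      \<forall>j<pdim d K M. -B \<le> a j \<and> a j < b j \<and> b j \<le> B}"

definition ELBO :: "nat \<Rightarrow> (nat \<Rightarrow> (nat \<Rightarrow> real)) \<Rightarrow> nat \<Rightarrow> nat \<Rightarrow> nat \<Rightarrow> (nat \<Rightarrow> real)
      \<Rightarrow> (nat \<Rightarrow> real) measure \<Rightarrow> (nat \<Rightarrow> real) measure \<Rightarrow> real" where
  "ELBO d xs n K M Y Xi Pr =
     - (\<integral>\<theta>. ln (lik xs n (net d K M \<theta>) Y) \<partial>Xi) + KL_divergence (exp 1) Pr Xi"

definition alpha :: "real \<Rightarrow> (nat \<times> nat) set \<Rightarrow> nat \<Rightarrow> nat \<times> nat \<Rightarrow> real" where
  "alpha b0 Ms n KM = exp (- b0 * (real (fst KM * snd KM))\<^sup>2 * ln (real n))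
       / (\<Sum>KM'\<in>Ms. exp (- b0 * (real (fst KM' * snd KM'))\<^sup>2 * ln (real n)))"

definition outer_exp :: "'a measure \<Rightarrow> ('a \<Rightarrow> ennreal) \<Rightarrow> ennreal" where
  "outer_exp P h = (INF g\<in>{g\<in>borel_measurable P. \<forall>y\<in>space P. h y \<le> g y}. nn_integral P g)"


definition eps_n :: "nat \<Rightarrow> (nat \<times> nat) set \<Rightarrow> real \<Rightarrow> ((nat \<Rightarrow> real) \<Rightarrow> real) set \<Rightarrow> nat \<Rightarrow> ereal" where
  "eps_n d Ms B Fs n = (INF KM\<in>Ms.
      (SUP f\<in>Fs. INF \<theta>\<in>ThetaB d (fst KM) (snd KM) B. supnorm d (\<lambda>x. net d (fst KM) (snd KM) \<theta> x - f x))
      + ereal (real (fst KM * snd KM) * sqrt (ln (real n) / real n)))"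

definition gamma_hat :: "nat \<Rightarrow> (nat \<Rightarrow> (nat \<Rightarrow> real)) \<Rightarrow> real \<Rightarrow> (nat \<times> nat) set \<Rightarrow> real \<Rightarrow> nat
      \<Rightarrow> (nat \<times> nat \<Rightarrow> (nat \<Rightarrow> real) measure) \<Rightarrow> (nat \<Rightarrow> real) \<Rightarrow> nat \<times> nat \<Rightarrow> real" where
  "gamma_hat d xs b0 Ms B n Xi Y KM =
     (let w = (\<lambda>KM'. alpha b0 Ms n KM' *
                 exp (- ELBO d xs n (fst KM') (snd KM') Y (Xi KM') (prior_KM d (fst KM') (snd KM') B)))
      in w KM / (\<Sum>KM'\<in>Ms. w KM'))"

(* Xi_hat_n(S) for the event S = {theta. P (net theta)}, with Xi_hat_n the mixture
   sum_{(K,M)} gamma_hat_{n,(K,M)} Xi_hat_{n,(K,M)} *)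
definition post_mass :: "nat \<Rightarrow> (nat \<Rightarrow> (nat \<Rightarrow> real)) \<Rightarrow> real \<Rightarrow> (nat \<times> nat) set \<Rightarrow> real \<Rightarrow> nat
      \<Rightarrow> (nat \<times> nat \<Rightarrow> (nat \<Rightarrow> real) measure) \<Rightarrow> (nat \<Rightarrow> real)
      \<Rightarrow> (((nat \<Rightarrow> real) \<Rightarrow> real) \<Rightarrow> bool) \<Rightarrow> real" where
  "post_mass d xs b0 Ms B n Xi Y P =
     (\<Sum>KM\<in>Ms. gamma_hat d xs b0 Ms B n Xi Y KM *
         measure (Xi KM) {\<theta>\<in>space (Xi KM). P (net d (fst KM) (snd KM) \<theta>)})"

end

(* Write z_i = Y_i - f(x_i), g_i = net(theta)(x_i) - f(x_i) and N = n eps_n^2.  Up to a term that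
   does not depend on theta, the log-likelihood is llr(theta) = <z, g> - |g|^2/2, and every
   exp(<z, v> - |v|^2/2) has expectation 1.  So with high probability the prior integrals of
   exp(llr) and of exp(<z, g>/2 - |g|^2/8) are at most exp(m N) for every architecture.
   (1) Jensen turns the first integral into an upper bound m N for all -ELBO values (up to the common
       term); with the prior weights alpha, architectures with (K M)^2 log n much larger than N
       receive negligible weight.
   (2) A network is Lipschitz in its parameters, so the second integrand at theta is controlled by
       its prior integral over a tiny box around theta, whose log prior mass is at least
       -C (K M)^2 log n.  Hence llr(theta) <= -|g|^2/8 + C (K M)^2 log n + 2 m N + 6 for all theta
       simultaneously; this takes the place of tests and covering numbers.
   (3) A box around a nearly optimal theta_0 shows that the normalising sum is at least exp(-C N).
   An architecture of moderate size that gives mass rho to {|g|^2 >= A^2 N} therefore has weight at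
   most exp((C - A^2 rho/8) N), which forces rho = O(1/A^2) or a negligible weight. *)
theory Submission
  imports Defs "HOL-Real_Asymp.Real_Asymp"
begin

section \<open>Products of uniform distributions\<close>

text \<open>A set of arbitrary functions, constrained at the first \<open>p\<close> indices, so that
  points of the box can be handled without carrying an extensionality condition along.\<close>

definition coord_box :: "nat \<Rightarrow> (nat \<Rightarrow> real) \<Rightarrow> (nat \<Rightarrow> real) \<Rightarrow> (nat \<Rightarrow> real) set" where
  "coord_box p a b = {\<theta>. \<forall>j<p. \<theta> j \<in> {a j..b j}}"

text \<open>The logarithmic volume ratio of the cube with side \<open>2 B\<close> and a subbox; it is both the
  KL divergence of the uniform distribution on the subbox from the prior and minus the log prior
  mass of the subbox.\<close>

definition log_ratio :: "nat \<Rightarrow> real \<Rightarrow> (nat \<Rightarrow> real) \<Rightarrow> (nat \<Rightarrow> real) \<Rightarrow> real" where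
  "log_ratio p B a b = (\<Sum>j<p. ln (2 * B / (b j - a j)))"

lemma sets_unif_prod [measurable_cong]:
  "sets (unif_prod p a b) = sets (PiM {..<p} (\<lambda>_. borel))"
  unfolding unif_prod_def by (rule sets_PiM_cong) auto

lemma prob_space_uniform_interval:
  fixes a b :: real
  assumes "a < b"
  shows "prob_space (uniform_measure lborel {a..b})"
  using assms by (intro prob_space_uniform_measure) (auto simp: ennreal_eq_0_iff)

lemma prob_space_unif_prod:
  assumes "\<And>j. j < p \<Longrightarrow> a j < b j"
  shows "prob_space (unif_prod p a b)"
  unfolding unif_prod_def
  by (rule prob_space_PiM) (use assms prob_space_uniform_interval in auto)

lemma unif_prod_cong:
  assumes "\<And>j. j < p \<Longrightarrow> a j = a' j" "\<And>j. j < p \<Longrightarrow> b j = b' j"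
  shows "unif_prod p a b = unif_prod p a' b'"
  unfolding unif_prod_def by (rule PiM_cong) (use assms in auto)

text \<open>Stated for every index \<open>j\<close> because \<open>Wt\<close> and \<open>bt\<close>
  read entries at computed positions; measurability of the network then requires no index
  arithmetic.\<close>

lemma borel_measurable_coordinate [measurable]:
  "(\<lambda>\<theta>. \<theta> j :: real) \<in> borel_measurable (PiM {..<p} (\<lambda>_. borel))"
proof (cases "j < p")
  case False \<comment> \<open>outside the index set all points of the product space take the value \<open>undefined\<close>\<close>
  then have "\<theta> j = undefined" if "\<theta> \<in> space (PiM {..<p} (\<lambda>_. borel :: real measure))" for \<theta>
    using that by (auto simp: space_PiM PiE_def extensional_def)
  then show ?thesis by (subst measurable_cong[where g = "\<lambda>_. undefined"]) auto
qed auto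

lemma borel_measurable_indicator_coord_box [measurable]:
  "(\<lambda>\<theta>. indicator (coord_box p a b) \<theta> :: real) \<in> borel_measurable (PiM {..<p} (\<lambda>_. borel))"
proof -
  have "Measurable.pred (PiM {..<p} (\<lambda>_. borel)) (\<lambda>\<theta>. \<theta> \<in> coord_box p a b)"
    unfolding coord_box_def by measurable
  then show ?thesis unfolding indicator_def of_bool_def by measurable
qed

lemma exp_log_ratio:
  assumes "\<And>j. j < p \<Longrightarrow> a j < b j" "B > 0"
  shows "exp (log_ratio p B a b) = (\<Prod>j<p. 2 * B / (b j - a j))"
  unfolding log_ratio_def using assms by (subst exp_sum) (auto intro!: prod.cong)

lemma log_ratio_nonneg:
  assumes "\<forall>j<p. - B \<le> a j \<and> a j < b j \<and> b j \<le> B"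
  shows "0 \<le> log_ratio p B a b"
  unfolding log_ratio_def
proof (rule sum_nonneg)
  fix j assume "j \<in> {..<p}"
  then show "0 \<le> ln (2 * B / (b j - a j))"
    using assms by (intro ln_ge_zero) (auto simp: field_simps)
qed

text \<open>A product measure is determined on rectangles, and there the density factorises: in each
  coordinate the factor \<open>2 * B / (b j - a j)\<close> on the small interval turns the uniform
  law on the large interval into the one on the small interval.\<close>

lemma unif_prod_eq_density:
  assumes ab: "\<forall>j<p. - B \<le> a j \<and> a j < b j \<and> b j \<le> B" and B: "B > 0"
  shows "unif_prod p a b = density (unif_prod p (\<lambda>_. - B) (\<lambda>_. B))
           (\<lambda>\<theta>. ennreal (exp (log_ratio p B a b) * indicator (coord_box p a b) \<theta>))"
proof -
  \<comment> \<open>The product locale asks for sigma-finite factors at all indices, so beyond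
    \<open>p\<close> the bounds are completed by those of the full interval.\<close>
  define a' where "a' j = (if j < p then a j else - B)" for j
  define b' where "b' j = (if j < p then b j else B)" for j
  have ab': "- B \<le> a' j" "a' j < b' j" "b' j \<le> B" for j
    using ab B by (auto simp: a'_def b'_def)
  have eq: "unif_prod p a b = unif_prod p a' b'" "log_ratio p B a b = log_ratio p B a' b'"
       "coord_box p a b = coord_box p a' b'"
    by (rule unif_prod_cong) (auto simp: a'_def b'_def log_ratio_def coord_box_def)
  let ?M = "\<lambda>j. uniform_measure lborel {a' j..b' j}"
  let ?U = "\<lambda>j::nat. uniform_measure lborel {- B..B}"
  interpret M: product_sigma_finite ?M
    unfolding product_sigma_finite_def
    using ab' prob_space_uniform_interval prob_space_imp_sigma_finite by blast
  interpret U: product_sigma_finite ?U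
    unfolding product_sigma_finite_def
    using B prob_space_uniform_interval[of "-B" B] prob_space_imp_sigma_finite by auto
  let ?d = "\<lambda>\<theta>. ennreal (exp (log_ratio p B a' b') * indicator (coord_box p a' b') \<theta>)"
  have "density (PiM {..<p} ?U) ?d = PiM {..<p} ?M"
  proof (rule M.PiM_eqI)
    show "sets (density (PiM {..<p} ?U) ?d) = sets (PiM {..<p} ?M)"
      unfolding sets_density by (rule sets_PiM_cong) auto
    fix A assume A: "\<And>i. i \<in> {..<p} \<Longrightarrow> A i \<in> sets (?M i)"
    then have A': "A j \<in> sets borel" if "j < p" for j using that by simp
    let ?g = "\<lambda>j t. ennreal (2 * B / (b' j - a' j)) * indicator ({a' j..b' j} \<inter> A j) t"
    have "(\<lambda>\<theta>. indicator (coord_box p a' b') \<theta> :: real) \<in> borel_measurable (PiM {..<p} ?U)"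
      using borel_measurable_indicator_coord_box sets_unif_prod[of p "\<lambda>_. -B" "\<lambda>_. B"]
      by (simp add: unif_prod_def cong: measurable_cong_sets)
    then have md: "?d \<in> borel_measurable (PiM {..<p} ?U)" by simp
    have "emeasure (density (PiM {..<p} ?U) ?d) (Pi\<^sub>E {..<p} A)
        = (\<integral>\<^sup>+\<theta>. ?d \<theta> * indicator (Pi\<^sub>E {..<p} A) \<theta> \<partial>PiM {..<p} ?U)"
      using A by (intro emeasure_density md) (auto intro!: sets_PiM_I_finite)
    also have "\<dots> = (\<integral>\<^sup>+\<theta>. (\<Prod>j<p. ?g j (\<theta> j)) \<partial>PiM {..<p} ?U)"
    proof (rule nn_integral_cong)
      fix \<theta> assume th: "\<theta> \<in> space (PiM {..<p} ?U)"
      have "(\<Prod>j<p. ?g j (\<theta> j)) = (\<Prod>j<p. ennreal (2 * B / (b' j - a' j)))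
              * (\<Prod>j<p. indicator ({a' j..b' j} \<inter> A j) (\<theta> j))"
        by (rule prod.distrib)
      also have "(\<Prod>j<p. ennreal (2 * B / (b' j - a' j))) = ennreal (exp (log_ratio p B a' b'))"
        using ab' B by (subst exp_log_ratio) (auto intro!: prod_ennreal simp: less_imp_le)
      also have "(\<Prod>j<p. indicator ({a' j..b' j} \<inter> A j) (\<theta> j))
          = (indicator (coord_box p a' b') \<theta> * indicator (Pi\<^sub>E {..<p} A) \<theta> :: ennreal)"
      proof (cases "\<theta> \<in> coord_box p a' b' \<and> \<theta> \<in> Pi\<^sub>E {..<p} A")
        case True
        then have "\<theta> j \<in> {a' j..b' j} \<inter> A j" if "j < p" for j
          using that by (auto simp: coord_box_def PiE_def Pi_def)
        then have "(\<Prod>j<p. indicator ({a' j..b' j} \<inter> A j) (\<theta> j) :: ennreal) = 1"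
          by (intro prod.neutral) (auto simp: indicator_def)
        then show ?thesis using True by simp
      next
        case False
        then obtain j where "j < p" "\<theta> j \<notin> {a' j..b' j} \<inter> A j"
          using th by (auto simp: coord_box_def space_PiM PiE_def Pi_def)
        then have "(\<Prod>j<p. indicator ({a' j..b' j} \<inter> A j) (\<theta> j) :: ennreal) = 0"
          by (intro prod_zero bexI[of _ j]) auto
        then show ?thesis using False by (auto simp: indicator_def)
      qed
      finally show "?d \<theta> * indicator (Pi\<^sub>E {..<p} A) \<theta> = (\<Prod>j<p. ?g j (\<theta> j))"
        by (simp add: indicator_def)
    qed
    also have "\<dots> = (\<Prod>j<p. \<integral>\<^sup>+t. ?g j t \<partial>?U j)"
      using A' by (intro U.product_nn_integral_prod borel_measurable_times_ennreal borel_measurable_indicator) auto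
    also have "\<dots> = (\<Prod>j<p. emeasure (?M j) (A j))"
    proof (rule prod.cong)
      fix j assume j: "j \<in> {..<p}"
      then have "A j \<in> sets borel" using A' by simp
      moreover have "{- B..B} \<inter> ({a' j..b' j} \<inter> A j) = {a' j..b' j} \<inter> A j" using ab'[of j] by auto
      moreover have "emeasure lborel ({a' j..b' j} \<inter> A j) \<noteq> \<infinity>"
        using emeasure_mono[of "{a' j..b' j} \<inter> A j" "{a' j..b' j}" lborel] ab'(2)[of j]
        by (auto simp: top_unique)
      then obtain r where "r \<ge> 0" "emeasure lborel ({a' j..b' j} \<inter> A j) = ennreal r"
        by (cases "emeasure lborel ({a' j..b' j} \<inter> A j)") auto
      ultimately show "(\<integral>\<^sup>+t. ?g j t \<partial>?U j) = emeasure (?M j) (A j)"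
        using ab'(2)[of j] B
        by (subst nn_integral_cmult_indicator)
           (simp_all add: divide_ennreal ennreal_mult'[symmetric])
    qed simp
    finally show "emeasure (density (PiM {..<p} ?U) ?d) (Pi\<^sub>E {..<p} A)
        = (\<Prod>j<p. emeasure (?M j) (A j))" .
  qed simp
  then show ?thesis unfolding eq by (simp add: unif_prod_def)
qed

text \<open>Lets bounds that are known on the box only enter integrals over the product
  measure.\<close>

lemma AE_unif_prod_coord_box:
  assumes "\<forall>j<p. - B \<le> a j \<and> a j < b j \<and> b j \<le> B" "B > 0"
  shows "AE \<theta> in unif_prod p a b. \<theta> \<in> coord_box p a b"
proof -
  have "(\<lambda>\<theta>. ennreal (exp (log_ratio p B a b) * indicator (coord_box p a b) \<theta>))
      \<in> borel_measurable (unif_prod p (\<lambda>_. - B) (\<lambda>_. B))"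
    by measurable
  then show ?thesis
    unfolding unif_prod_eq_density[OF assms] by (subst AE_density) (auto simp: indicator_def)
qed

lemma nn_integral_unif_prod:
  assumes "\<forall>j<p. - B \<le> a j \<and> a j < b j \<and> b j \<le> B" "B > 0"
    and [measurable]: "h \<in> borel_measurable (PiM {..<p} (\<lambda>_. borel))"
  shows "(\<integral>\<^sup>+\<theta>. h \<theta> \<partial>unif_prod p a b)
    = ennreal (exp (log_ratio p B a b)) * (\<integral>\<^sup>+\<theta>. indicator (coord_box p a b) \<theta> * h \<theta> \<partial>unif_prod p (\<lambda>_. - B) (\<lambda>_. B))"
proof -
  have [measurable]: "(\<lambda>\<theta>. indicator (coord_box p a b) \<theta> :: ennreal) \<in> borel_measurable (PiM {..<p} (\<lambda>_. borel))"
    using measurable_compose[OF borel_measurable_indicator_coord_box measurable_ennreal, of p a b]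
    by (simp add: ennreal_indicator)
  show ?thesis
    unfolding unif_prod_eq_density[OF assms(1,2)]
    by (subst nn_integral_density)
       (auto simp: ennreal_mult' nn_integral_cmult[symmetric] ennreal_indicator mult.assoc intro!: nn_integral_cong)
qed

text \<open>On the box the density is the constant \<open>exp (log_ratio p B a b)\<close>, so its
  logarithm is constant there. \<open>KL_divergence\<close> takes the reference measure first: this
  is the divergence of the subbox law from the prior.\<close>

lemma KL_unif_prod:
  assumes "\<forall>j<p. - B \<le> a j \<and> a j < b j \<and> b j \<le> B" "B > 0"
  shows "KL_divergence (exp 1) (unif_prod p (\<lambda>_. - B) (\<lambda>_. B)) (unif_prod p a b) = log_ratio p B a b"
proof -
  let ?P = "unif_prod p (\<lambda>_. - B) (\<lambda>_. B)" and ?k = "log_ratio p B a b"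
  interpret prob_space ?P using assms(2) by (intro prob_space_unif_prod) auto
  interpret Q: prob_space "unif_prod p a b" using assms(1) by (intro prob_space_unif_prod) auto
  let ?f = "\<lambda>\<theta>. exp ?k * indicator (coord_box p a b) \<theta>"
  have "KL_divergence (exp 1) ?P (unif_prod p a b) = (\<integral>\<theta>. ?f \<theta> * log (exp 1) (?f \<theta>) \<partial>?P)"
    unfolding unif_prod_eq_density[OF assms] by (rule KL_density) auto
  also have "\<dots> = (\<integral>\<theta>. ?f \<theta> * ?k \<partial>?P)"
    by (intro Bochner_Integration.integral_cong) (auto simp: indicator_def log_def)
  also have "\<dots> = (\<integral>\<theta>. ?k \<partial>density ?P (\<lambda>\<theta>. ennreal (?f \<theta>)))"
    by (subst integral_real_density) auto
  also have "\<dots> = ?k"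
    unfolding unif_prod_eq_density[OF assms, symmetric] by (simp add: Q.prob_space)
  finally show ?thesis .
qed

section \<open>Networks as functions of their parameters\<close>

lemma lw_bounds:
  assumes "d \<ge> 1" "M \<ge> 1"
  shows "lw d K M k \<le> d * M" "lw d K M (Suc k) \<le> M"
proof -
  have "d * 1 \<le> d * M" "1 * M \<le> d * M" using assms by (intro mult_le_mono; simp)+
  then show "lw d K M k \<le> d * M" "lw d K M (Suc k) \<le> M" using assms unfolding lw_def by auto
qed

lemma poff_mono: "k \<le> l \<Longrightarrow> poff d K M k \<le> poff d K M l"
  unfolding poff_def by (intro sum_mono2) auto

text \<open>Layer \<open>k\<close> stores one row of \<open>lw d K M k + 1\<close> entries per
  output unit, the weights followed by the bias. The value \<open>j = lw d K M k\<close> is the bias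
  position, hence the non-strict bound.\<close>

lemma param_index_less:
  assumes "k < K" "i < lw d K M (Suc k)" "j \<le> lw d K M k"
  shows "poff d K M k + i * (lw d K M k + 1) + j < pdim d K M"
proof -
  have "i * (lw d K M k + 1) + j < (i + 1) * (lw d K M k + 1)" using assms(3) by simp
  also have "\<dots> \<le> lw d K M (Suc k) * (lw d K M k + 1)" using assms(2) by (intro mult_le_mono1) simp
  finally have "poff d K M k + i * (lw d K M k + 1) + j < poff d K M (Suc k)"
    by (simp add: poff_def)
  also have "\<dots> \<le> pdim d K M" unfolding pdim_def using assms(1) by (intro poff_mono) simp
  finally show ?thesis .
qed

text \<open>Each of the \<open>K\<close> layers has at most \<open>2 * d * M\<^sup>2\<close>
  parameters. A second factor \<open>K\<close> comes later from the logarithm of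
  \<open>Q ^ K\<close>, which leads to the order (K M)^2 log n.\<close>

lemma pdim_le:
  assumes "d \<ge> 1" "M \<ge> 1"
  shows "pdim d K M \<le> 2 * d * K * M\<^sup>2"
proof -
  have "lw d K M (Suc j) * (lw d K M j + 1) \<le> M * (d * M + d * M)" for j
    using lw_bounds[OF assms, of K] assms by (intro mult_le_mono add_mono) auto
  then have "pdim d K M \<le> (\<Sum>j<K. M * (d * M + d * M))"
    unfolding pdim_def poff_def by (intro sum_mono)
  then show ?thesis by (simp add: power2_eq_square algebra_simps)
qed

section \<open>Growth and parameter-Lipschitz bounds for networks on the cube\<close>

context
  fixes d K M :: nat and B Q :: real
  assumes d: "d \<ge> 1" and K: "K \<ge> 1" and M: "M \<ge> 1" and B: "B \<ge> 1"
  defines "Q \<equiv> B * (real (d * M) + 1)"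
begin

lemma Q_ge: "Q \<ge> real (d * M) + 1" "Q \<ge> 1"
proof -
  have "1 * (real (d * M) + 1) \<le> Q" unfolding Q_def using B by (intro mult_right_mono) auto
  then show "Q \<ge> real (d * M) + 1" by simp
  then show "Q \<ge> 1" using of_nat_0_le_iff[of "d * M", where 'a = real] by linarith
qed

text \<open>At most \<open>d * M\<close> products, each bounded by \<open>B * V\<close>, plus a bias
  bounded by \<open>B\<close>, which is at most \<open>B * V\<close>: this makes \<open>Q\<close>
  the growth factor of one layer.\<close>

lemma abs_aff_le:
  assumes th: "\<forall>j<pdim d K M. \<bar>\<theta> j\<bar> \<le> B" and v: "\<And>j. j < lw d K M k \<Longrightarrow> \<bar>v j\<bar> \<le> V"
    and V: "V \<ge> 1" and k: "k < K" and i: "i < lw d K M (Suc k)"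
  shows "\<bar>aff d K M \<theta> k v i\<bar> \<le> Q * V"
proof -
  let ?W = "Wt d K M \<theta> k i" and ?w = "lw d K M k"
  have W: "\<bar>?W j\<bar> \<le> B" if "j < ?w" for j
    unfolding Wt_def using th param_index_less[OF k i] that by simp
  have b: "\<bar>bt d K M \<theta> k i\<bar> \<le> B" unfolding bt_def using th param_index_less[OF k i] by simp
  have "\<bar>\<Sum>j<?w. ?W j * v j\<bar> \<le> (\<Sum>j<?w. \<bar>?W j * v j\<bar>)" by (rule sum_abs)
  also have "\<dots> \<le> (\<Sum>j<?w. B * V)"
    unfolding abs_mult using W v B by (intro sum_mono mult_mono) auto
  also have "\<dots> = real ?w * (B * V)" by simp
  also have "\<dots> \<le> real (d * M) * (B * V)"
    using lw_bounds(1)[OF d M, of K k] B V by (intro mult_right_mono of_nat_mono) auto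
  finally have "\<bar>aff d K M \<theta> k v i\<bar> \<le> real (d * M) * (B * V) + B" unfolding aff_def using b by linarith
  also have "\<dots> \<le> real (d * M) * (B * V) + B * V" using B V by simp
  also have "\<dots> = Q * V" unfolding Q_def by (simp add: algebra_simps)
  finally show ?thesis .
qed

text \<open>The splitting W'v' - Wv = (W' - W)v' + W(v' - v) separates the parameter error from the
  input error; the size bounds accordingly fall on \<open>v'\<close> and on
  \<open>\<theta>\<close>.\<close>

lemma abs_aff_diff_le:
  assumes th: "\<forall>j<pdim d K M. \<bar>\<theta> j\<bar> \<le> B" and diff: "\<forall>j<pdim d K M. \<bar>\<theta>' j - \<theta> j\<bar> \<le> \<delta>"
    and v: "\<And>j. j < lw d K M k \<Longrightarrow> \<bar>v' j\<bar> \<le> V" and V: "V \<ge> 1"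
    and vv: "\<And>j. j < lw d K M k \<Longrightarrow> \<bar>v' j - v j\<bar> \<le> D" and D: "D \<ge> 0" "\<delta> \<ge> 0"
    and k: "k < K" and i: "i < lw d K M (Suc k)"
  shows "\<bar>aff d K M \<theta>' k v' i - aff d K M \<theta> k v i\<bar> \<le> Q * (\<delta> * V + D)"
proof -
  let ?W = "Wt d K M \<theta> k i" and ?W' = "Wt d K M \<theta>' k i" and ?w = "lw d K M k"
  have W: "\<bar>?W j\<bar> \<le> B" if "j < ?w" for j
    unfolding Wt_def using th param_index_less[OF k i] that by simp
  have WW: "\<bar>?W' j - ?W j\<bar> \<le> \<delta>" if "j < ?w" for j
    unfolding Wt_def using diff param_index_less[OF k i] that by simp
  have b: "\<bar>bt d K M \<theta>' k i - bt d K M \<theta> k i\<bar> \<le> \<delta>"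
    unfolding bt_def using diff param_index_less[OF k i] by simp
  have "\<bar>(\<Sum>j<?w. ?W' j * v' j) - (\<Sum>j<?w. ?W j * v j)\<bar>
      = \<bar>\<Sum>j<?w. (?W' j - ?W j) * v' j + ?W j * (v' j - v j)\<bar>"
    by (simp add: sum_subtractf[symmetric] algebra_simps)
  also have "\<dots> \<le> (\<Sum>j<?w. \<bar>(?W' j - ?W j) * v' j + ?W j * (v' j - v j)\<bar>)" by (rule sum_abs)
  also have "\<dots> \<le> (\<Sum>j<?w. \<delta> * V + B * D)"
  proof (rule sum_mono)
    fix j assume j: "j \<in> {..<?w}"
    have "\<bar>(?W' j - ?W j) * v' j\<bar> \<le> \<delta> * V" "\<bar>?W j * (v' j - v j)\<bar> \<le> B * D"
      unfolding abs_mult using j W WW v vv B D by (intro mult_mono; simp)+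
    then show "\<bar>(?W' j - ?W j) * v' j + ?W j * (v' j - v j)\<bar> \<le> \<delta> * V + B * D" by linarith
  qed
  also have "\<dots> = real ?w * (\<delta> * V + B * D)" by simp
  also have "\<dots> \<le> real (d * M) * (\<delta> * V + B * D)"
    using lw_bounds(1)[OF d M, of K k] B V D by (intro mult_right_mono of_nat_mono) auto
  finally have "\<bar>aff d K M \<theta>' k v' i - aff d K M \<theta> k v i\<bar> \<le> real (d * M) * (\<delta> * V + B * D) + \<delta>"
    unfolding aff_def using b by linarith
  also have "\<dots> = (real (d * M) * (\<delta> * V) + \<delta> * 1) + real (d * M) * (B * D)" by (simp add: algebra_simps)
  also have "\<dots> \<le> (real (d * M) * (\<delta> * V) + \<delta> * V) + (real (d * M) * (B * D) + B * D)"
    using V B D by (intro add_mono mult_left_mono) auto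
  also have "\<dots> = (real (d * M) + 1) * (\<delta> * V) + Q * D" by (simp add: Q_def algebra_simps)
  also have "\<dots> \<le> Q * (\<delta> * V) + Q * D"
    using Q_ge V D by (intro add_mono mult_right_mono) auto
  finally show ?thesis by (simp add: algebra_simps)
qed

lemma abs_hid_le:
  assumes th: "\<forall>j<pdim d K M. \<bar>\<theta> j\<bar> \<le> B" and x: "x \<in> cube d"
  shows "k < K \<Longrightarrow> i < lw d K M k \<Longrightarrow> \<bar>hid d K M \<theta> k x i\<bar> \<le> Q ^ k"
proof (induction k arbitrary: i)
  case 0
  then show ?case using x by (auto simp: lw_def cube_def abs_if)
next
  case (Suc k)
  have "\<bar>aff d K M \<theta> k (hid d K M \<theta> k x) i\<bar> \<le> Q * Q ^ k"
    using Suc Q_ge(2) by (intro abs_aff_le[OF th]) auto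
  then show ?case by simp linarith
qed

text \<open>ReLU is 1-Lipschitz, so the errors obey the recursion D_{k+1} = Q (\<delta> Q^k + D_k)
  with D_0 = 0, which \<open>\<delta> * k * Q ^ k\<close> solves.\<close>

lemma abs_hid_diff_le:
  assumes th: "\<forall>j<pdim d K M. \<bar>\<theta> j\<bar> \<le> B" and th': "\<forall>j<pdim d K M. \<bar>\<theta>' j\<bar> \<le> B"
    and diff: "\<forall>j<pdim d K M. \<bar>\<theta>' j - \<theta> j\<bar> \<le> \<delta>" and "\<delta> \<ge> 0" and x: "x \<in> cube d"
  shows "k < K \<Longrightarrow> i < lw d K M k \<Longrightarrow> \<bar>hid d K M \<theta>' k x i - hid d K M \<theta> k x i\<bar> \<le> \<delta> * k * Q ^ k"
proof (induction k arbitrary: i)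
  case (Suc k)
  have "\<bar>aff d K M \<theta>' k (hid d K M \<theta>' k x) i - aff d K M \<theta> k (hid d K M \<theta> k x) i\<bar>
      \<le> Q * (\<delta> * Q ^ k + \<delta> * k * Q ^ k)"
    using Suc Q_ge(2) abs_hid_le[OF th' x] \<open>\<delta> \<ge> 0\<close> by (intro abs_aff_diff_le[OF th diff]) auto
  also have "\<dots> = \<delta> * Suc k * Q ^ Suc k" by (simp add: algebra_simps)
  finally show ?case by (auto simp: max_def split: if_splits)
qed simp

lemma abs_net_le:
  assumes th: "\<forall>j<pdim d K M. \<bar>\<theta> j\<bar> \<le> B" and x: "x \<in> cube d"
  shows "\<bar>net d K M \<theta> x\<bar> \<le> Q ^ K"
proof -
  have "\<bar>net d K M \<theta> x\<bar> \<le> Q * Q ^ (K - 1)"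
    unfolding net_def using K Q_ge(2) abs_hid_le[OF th x]
    by (intro abs_aff_le[OF th]) (auto simp: lw_def)
  then show ?thesis using K by (simp add: power_eq_if)
qed

text \<open>One further step of the recursion for the output layer, which is affine without ReLU and
  so lies outside \<open>hid\<close>.\<close>

lemma abs_net_diff_le:
  assumes th: "\<forall>j<pdim d K M. \<bar>\<theta> j\<bar> \<le> B" and th': "\<forall>j<pdim d K M. \<bar>\<theta>' j\<bar> \<le> B"
    and diff: "\<forall>j<pdim d K M. \<bar>\<theta>' j - \<theta> j\<bar> \<le> \<delta>" and "\<delta> \<ge> 0" and x: "x \<in> cube d"
  shows "\<bar>net d K M \<theta>' x - net d K M \<theta> x\<bar> \<le> \<delta> * K * Q ^ K"
proof -
  have k: "K - 1 < K" using K by simp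
  have "\<bar>net d K M \<theta>' x - net d K M \<theta> x\<bar> \<le> Q * (\<delta> * Q ^ (K - 1) + \<delta> * real (K - 1) * Q ^ (K - 1))"
    unfolding net_def
  proof (rule abs_aff_diff_le[OF th diff _ _ _ _ \<open>\<delta> \<ge> 0\<close> k])
    show "\<bar>hid d K M \<theta>' (K - 1) x j\<bar> \<le> Q ^ (K - 1)" if "j < lw d K M (K - 1)" for j
      using abs_hid_le[OF th' x k that] .
    show "\<bar>hid d K M \<theta>' (K - 1) x j - hid d K M \<theta> (K - 1) x j\<bar> \<le> \<delta> * real (K - 1) * Q ^ (K - 1)"
      if "j < lw d K M (K - 1)" for j
      using abs_hid_diff_le[OF assms k that] .
  qed (use K Q_ge(2) \<open>\<delta> \<ge> 0\<close> in \<open>auto simp: lw_def\<close>)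
  also have "\<dots> = \<delta> * K * (Q * Q ^ (K - 1))" using K by (simp add: algebra_simps of_nat_diff)
  also have "Q * Q ^ (K - 1) = Q ^ K" using K by (simp add: power_eq_if)
  finally show ?thesis .
qed

end

lemma borel_measurable_hid:
  "(\<lambda>\<theta>. hid d K M \<theta> k x i) \<in> borel_measurable (PiM {..<p} (\<lambda>_. borel))"
proof (induction k arbitrary: i)
  case (Suc k)
  note Suc[measurable]
  show ?case unfolding hid.simps aff_def Wt_def bt_def by measurable
qed simp

lemma borel_measurable_net [measurable]:
  "(\<lambda>\<theta>. net d K M \<theta> x) \<in> borel_measurable (PiM {..<p} (\<lambda>_. borel))"
proof -
  note borel_measurable_hid[measurable]
  show ?thesis unfolding net_def aff_def Wt_def bt_def by measurable
qed

section \<open>Gaussian log-likelihood ratios\<close>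

text \<open>With \<open>z\<close> the noise Y - f at the inputs, this is the log-likelihood ratio of
  the mean f + g against the mean f.\<close>

definition llr :: "nat \<Rightarrow> (nat \<Rightarrow> real) \<Rightarrow> (nat \<Rightarrow> real) \<Rightarrow> real" where
  "llr n z g = (\<Sum>i\<in>{1..n}. z i * g i) - (\<Sum>i\<in>{1..n}. (g i)\<^sup>2) / 2"

lemma llr_scale: "llr n z (\<lambda>i. c * g i) = c * (\<Sum>i\<in>{1..n}. z i * g i) - c\<^sup>2 * (\<Sum>i\<in>{1..n}. (g i)\<^sup>2) / 2"
  unfolding llr_def by (simp add: sum_distrib_left power_mult_distrib mult.left_commute)

text \<open>There is no uniform bound on \<open>g\<close>, so the cross term \<open>g i * e\<close>
  is treated by |g| \<le> (1 + g^2) / 2. This is the origin of the quadratic error term, which is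
  later absorbed by the quadratic part of the log-likelihood ratio.\<close>

lemma llr_perturb:
  assumes z: "\<And>i. i \<in> {1..n} \<Longrightarrow> \<bar>z i\<bar> \<le> Z"
    and g: "\<And>i. i \<in> {1..n} \<Longrightarrow> \<bar>g' i - g i\<bar> \<le> \<eta>" and eta: "0 \<le> \<eta>" "\<eta> \<le> 1"
  shows "llr n z g - n * \<eta> * (Z + 1) - \<eta> / 2 * (\<Sum>i\<in>{1..n}. (g i)\<^sup>2) \<le> llr n z g'"
proof -
  have "llr n z g - n * \<eta> * (Z + 1) - \<eta> / 2 * (\<Sum>i\<in>{1..n}. (g i)\<^sup>2)
      = (\<Sum>i\<in>{1..n}. z i * g i - (g i)\<^sup>2 / 2 - \<eta> * (Z + 1) - \<eta> / 2 * (g i)\<^sup>2)"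
    by (simp add: llr_def sum_subtractf sum.distrib sum_divide_distrib sum_distrib_left algebra_simps)
  also have "\<dots> \<le> (\<Sum>i\<in>{1..n}. z i * g' i - (g' i)\<^sup>2 / 2)"
  proof (rule sum_mono)
    fix i assume i: "i \<in> {1..n}"
    define e where "e = g' i - g i"
    have e: "\<bar>e\<bar> \<le> \<eta>" using g[OF i] by (simp add: e_def)
    have "\<bar>z i * e\<bar> \<le> Z * \<eta>" unfolding abs_mult using z[OF i] e by (intro mult_mono) auto
    moreover have "\<bar>g i * e\<bar> \<le> (1 + (g i)\<^sup>2) / 2 * \<eta>"
    proof -
      have "0 \<le> (\<bar>g i\<bar> - 1)\<^sup>2" by simp
      then have "\<bar>g i\<bar> \<le> (1 + (g i)\<^sup>2) / 2" by (simp add: power2_diff)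
      then show ?thesis unfolding abs_mult using e by (intro mult_mono) auto
    qed
    moreover have "e\<^sup>2 \<le> \<eta>"
    proof -
      have "\<bar>e\<bar> * \<bar>e\<bar> \<le> \<eta> * 1" using e eta by (intro mult_mono) auto
      then show ?thesis by (simp add: power2_eq_square)
    qed
    moreover have "(g' i)\<^sup>2 = (g i)\<^sup>2 + 2 * (g i * e) + e\<^sup>2" "z i * g' i = z i * g i + z i * e"
      by (simp_all add: e_def power2_eq_square algebra_simps)
    moreover have "(1 + (g i)\<^sup>2) / 2 * \<eta> = \<eta> / 2 + \<eta> / 2 * (g i)\<^sup>2"
      by (simp add: algebra_simps)
    ultimately have "z i * g i - (g i)\<^sup>2 / 2 - (Z * \<eta> + \<eta>) - \<eta> / 2 * (g i)\<^sup>2 \<le> z i * g' i - (g' i)\<^sup>2 / 2"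
      unfolding abs_le_iff by linarith
    then show "z i * g i - (g i)\<^sup>2 / 2 - \<eta> * (Z + 1) - \<eta> / 2 * (g i)\<^sup>2 \<le> z i * g' i - (g' i)\<^sup>2 / 2"
      by (simp add: algebra_simps)
  qed
  also have "\<dots> = llr n z g'" by (simp add: llr_def sum_subtractf sum_divide_distrib)
  finally show ?thesis .
qed

text \<open>The log-likelihood of \<open>f\<close> itself in terms of the noise. It is the same for
  all networks and cancels when architectures are compared.\<close>

definition log_norm :: "nat \<Rightarrow> (nat \<Rightarrow> real) \<Rightarrow> real" where
  "log_norm n z = (\<Sum>i\<in>{1..n}. ln (1 / sqrt (2 * pi)) - (z i)\<^sup>2 / 2)"

text \<open>Expand the square of Y - h = z - g, with z = Y - f and g = h - f.\<close>

lemma ln_lik: "ln (lik xs n h Y) = log_norm n (\<lambda>i. Y i - f (xs i)) + llr n (\<lambda>i. Y i - f (xs i)) (\<lambda>i. h (xs i) - f (xs i))"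
proof -
  have "ln (lik xs n h Y) = (\<Sum>i\<in>{1..n}. ln (std_normal_density (Y i - h (xs i))))"
    unfolding lik_def by (intro ln_prod) (use normal_density_pos[of 1 0] in \<open>simp_all add: less_imp_neq[symmetric]\<close>)
  also have "\<dots> = (\<Sum>i\<in>{1..n}. ln (1 / sqrt (2 * pi)) - (Y i - h (xs i))\<^sup>2 / 2)"
    by (intro sum.cong refl) (subst std_normal_density_def, subst ln_mult, auto)
  also have "\<dots> = (\<Sum>i\<in>{1..n}. (ln (1 / sqrt (2 * pi)) - (Y i - f (xs i))\<^sup>2 / 2) +
      ((Y i - f (xs i)) * (h (xs i) - f (xs i)) - (h (xs i) - f (xs i))\<^sup>2 / 2))"
    by (intro sum.cong refl) (simp add: power2_eq_square field_simps)
  also have "\<dots> = log_norm n (\<lambda>i. Y i - f (xs i)) + llr n (\<lambda>i. Y i - f (xs i)) (\<lambda>i. h (xs i) - f (xs i))"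
    by (simp add: log_norm_def llr_def sum.distrib sum_subtractf sum_divide_distrib)
  finally show ?thesis .
qed

section \<open>The data distribution and exponential moments of likelihood ratios\<close>

lemma prob_space_Pdata: "prob_space (Pdata xs n f)"
  unfolding Pdata_def by (intro prob_space_PiM prob_space_normal_density) simp

lemma sets_Pdata [measurable_cong]: "sets (Pdata xs n f) = sets (PiM {1..n} (\<lambda>_. borel))"
  unfolding Pdata_def by (rule sets_PiM_cong) auto

text \<open>Exponential tilting: the factor moves the mean of the normal density from
  \<open>m\<close> to \<open>m + g\<close>, and the result is again a probability density.\<close>

lemma nn_integral_exp_tilt:
  "(\<integral>\<^sup>+y. ennreal (exp ((y - m) * g - g\<^sup>2 / 2)) \<partial>density lborel (normal_density m 1)) = 1"
proof -
  have "(\<integral>\<^sup>+y. ennreal (exp ((y - m) * g - g\<^sup>2 / 2)) \<partial>density lborel (normal_density m 1))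
      = (\<integral>\<^sup>+y. ennreal (normal_density m 1 y) * ennreal (exp ((y - m) * g - g\<^sup>2 / 2)) \<partial>lborel)"
    by (subst nn_integral_density) auto
  also have "\<dots> = (\<integral>\<^sup>+y. ennreal (normal_density (m + g) 1 y) \<partial>lborel)"
  proof (rule nn_integral_cong)
    fix y
    have "normal_density m 1 y * exp ((y - m) * g - g\<^sup>2 / 2) = normal_density (m + g) 1 y"
      unfolding normal_density_def
      by (simp add: mult_exp_exp power2_eq_square field_simps)
    then show "ennreal (normal_density m 1 y) * ennreal (exp ((y - m) * g - g\<^sup>2 / 2))
        = ennreal (normal_density (m + g) 1 y)"
      by (simp add: ennreal_mult'[symmetric])
  qed
  also have "\<dots> = emeasure (density lborel (normal_density (m + g) 1)) UNIV"
    by (subst emeasure_density) auto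
  also have "\<dots> = 1"
    using prob_space.emeasure_space_1[OF prob_space_normal_density[of 1 "m + g"]] by simp
  finally show ?thesis .
qed

lemma nn_integral_exp_llr:
  "(\<integral>\<^sup>+Y. ennreal (exp (llr n (\<lambda>i. Y i - f (xs i)) g)) \<partial>Pdata xs n f) = 1"
proof -
  let ?M = "\<lambda>i. density lborel (normal_density (f (xs i)) 1)"
  interpret product_sigma_finite ?M
    unfolding product_sigma_finite_def
    by (intro allI prob_space_imp_sigma_finite prob_space_normal_density) simp
  have "exp (llr n (\<lambda>i. Y i - f (xs i)) g) = (\<Prod>i\<in>{1..n}. exp ((Y i - f (xs i)) * g i - (g i)\<^sup>2 / 2))" for Y
    by (simp add: llr_def exp_sum[symmetric] sum_subtractf sum_divide_distrib)
  then have "(\<integral>\<^sup>+Y. ennreal (exp (llr n (\<lambda>i. Y i - f (xs i)) g)) \<partial>Pdata xs n f)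
      = (\<integral>\<^sup>+Y. (\<Prod>i\<in>{1..n}. ennreal (exp ((Y i - f (xs i)) * g i - (g i)\<^sup>2 / 2))) \<partial>PiM {1..n} ?M)"
    unfolding Pdata_def by (simp add: prod_ennreal)
  also have "\<dots> = (\<Prod>i\<in>{1..n}. \<integral>\<^sup>+y. ennreal (exp ((y - f (xs i)) * g i - (g i)\<^sup>2 / 2)) \<partial>?M i)"
    by (intro product_nn_integral_prod) auto
  also have "\<dots> = 1" by (simp add: nn_integral_exp_tilt)
  finally show ?thesis .
qed

lemma borel_measurable_llr_joint [measurable]:
  "(\<lambda>(Y, \<theta>). llr n (\<lambda>i. Y i - f (xs i)) (\<lambda>i. c * (net d K M \<theta> (xs i) - f (xs i))))
    \<in> borel_measurable (PiM {1..n} (\<lambda>_. borel) \<Otimes>\<^sub>M PiM {..<p} (\<lambda>_. borel))"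
proof -
  note measurable_compose[OF measurable_snd borel_measurable_net, measurable]
  show ?thesis unfolding llr_def split_beta' by measurable
qed

lemma borel_measurable_llr_fst [measurable]:
  "(\<lambda>Y. llr n (\<lambda>i. Y i - f (xs i)) g) \<in> borel_measurable (PiM {1..n} (\<lambda>_. borel))"
  unfolding llr_def by measurable

lemma borel_measurable_llr_snd [measurable]:
  "(\<lambda>\<theta>. llr n z (\<lambda>i. c * (net d K M \<theta> (xs i) - f (xs i)))) \<in> borel_measurable (PiM {..<p} (\<lambda>_. borel))"
  unfolding llr_def by measurable

text \<open>For \<open>c = 1\<close> this is the marginal likelihood of the architecture relative to
  the likelihood of \<open>f\<close>; for \<open>c = 1 / 2\<close> every network is first moved
  halfway towards \<open>f\<close>.\<close>

definition evidence :: "nat \<Rightarrow> (nat \<Rightarrow> nat \<Rightarrow> real) \<Rightarrow> nat \<Rightarrow> ((nat \<Rightarrow> real) \<Rightarrow> real) \<Rightarrow> real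
    \<Rightarrow> nat \<Rightarrow> nat \<Rightarrow> real \<Rightarrow> (nat \<Rightarrow> real) \<Rightarrow> ennreal" where
  "evidence d xs n f c K M B Y = (\<integral>\<^sup>+\<theta>. ennreal (exp (llr n (\<lambda>i. Y i - f (xs i))
      (\<lambda>i. c * (net d K M \<theta> (xs i) - f (xs i))))) \<partial>prior_KM d K M B)"

lemma sets_prior_KM [measurable_cong]: "sets (prior_KM d K M B) = sets (PiM {..<pdim d K M} (\<lambda>_. borel))"
  unfolding prior_KM_def by (rule sets_unif_prod)

lemma prob_space_prior_KM: "B > 0 \<Longrightarrow> prob_space (prior_KM d K M B)"
  unfolding prior_KM_def by (rule prob_space_unif_prod) auto

text \<open>Fubini puts the data integral inside, where it is 1 for each fixed \<theta>. The unit
  mean is what makes the integral of \<open>deviation\<close> small.\<close>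

lemma
  assumes "B > 0"
  shows borel_measurable_evidence: "evidence d xs n f c K M B \<in> borel_measurable (Pdata xs n f)"
    and nn_integral_evidence: "(\<integral>\<^sup>+Y. evidence d xs n f c K M B Y \<partial>Pdata xs n f) = 1"
proof -
  interpret P: prob_space "Pdata xs n f" by (rule prob_space_Pdata)
  interpret T: prob_space "prior_KM d K M B" using assms by (rule prob_space_prior_KM)
  interpret pair_sigma_finite "Pdata xs n f" "prior_KM d K M B" ..
  show "evidence d xs n f c K M B \<in> borel_measurable (Pdata xs n f)"
    unfolding evidence_def by measurable
  have "(\<integral>\<^sup>+Y. evidence d xs n f c K M B Y \<partial>Pdata xs n f)
      = (\<integral>\<^sup>+\<theta>. \<integral>\<^sup>+Y. ennreal (exp (llr n (\<lambda>i. Y i - f (xs i))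
      (\<lambda>i. c * (net d K M \<theta> (xs i) - f (xs i))))) \<partial>Pdata xs n f \<partial>prior_KM d K M B)"
    unfolding evidence_def by (rule Fubini'[symmetric]) measurable
  also have "\<dots> = 1" by (simp add: nn_integral_exp_llr T.emeasure_space_1)
  finally show "(\<integral>\<^sup>+Y. evidence d xs n f c K M B Y \<partial>Pdata xs n f) = 1" .
qed

section \<open>A single network architecture\<close>

text \<open>The cube of radius \<open>\<delta>\<close> around the centre is clipped to the parameter
  range. The centre lies in that range and \<open>\<delta> \<le> B\<close>, so at least width
  \<open>\<delta>\<close> survives in every coordinate.\<close>

lemma coord_box_around:
  assumes th: "\<forall>j<p. \<bar>\<theta>\<^sub>0 j\<bar> \<le> B" and del: "0 < \<delta>" "\<delta> \<le> B"
  obtains a b where "\<forall>j<p. - B \<le> a j \<and> a j < b j \<and> b j \<le> B"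
    and "\<And>\<theta>. \<theta> \<in> coord_box p a b \<Longrightarrow> \<forall>j<p. \<bar>\<theta> j - \<theta>\<^sub>0 j\<bar> \<le> \<delta>"
    and "log_ratio p B a b \<le> p * ln (2 * B / \<delta>)"
proof -
  define a where "a j = max (- B) (\<theta>\<^sub>0 j - \<delta>)" for j
  define b where "b j = min B (\<theta>\<^sub>0 j + \<delta>)" for j
  have width: "\<delta> \<le> b j - a j" if "j < p" for j
  proof -
    have "\<bar>\<theta>\<^sub>0 j\<bar> \<le> B" using th that by simp
    then show ?thesis using del by (auto simp: a_def b_def max_def min_def)
  qed
  have 1: "\<forall>j<p. - B \<le> a j \<and> a j < b j \<and> b j \<le> B"
  proof (intro allI impI)
    fix j assume "j < p"
    then have "a j < b j" using width[of j] del by linarith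
    then show "- B \<le> a j \<and> a j < b j \<and> b j \<le> B" by (simp add: a_def b_def)
  qed
  have 2: "\<forall>j<p. \<bar>\<theta> j - \<theta>\<^sub>0 j\<bar> \<le> \<delta>" if "\<theta> \<in> coord_box p a b" for \<theta>
    using that by (auto simp: coord_box_def a_def b_def abs_le_iff algebra_simps)
  have "log_ratio p B a b \<le> (\<Sum>j<p. ln (2 * B / \<delta>))"
    unfolding log_ratio_def
  proof (rule sum_mono)
    fix j assume "j \<in> {..<p}"
    then have j: "j < p" by simp
    have "2 * B / (b j - a j) \<le> 2 * B / \<delta>"
      using width[OF j] del by (intro divide_left_mono) auto
    moreover have "0 < 2 * B / (b j - a j)" using width[OF j] del by (intro divide_pos_pos) auto
    ultimately show "ln (2 * B / (b j - a j)) \<le> ln (2 * B / \<delta>)" by simp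
  qed
  then have 3: "log_ratio p B a b \<le> p * ln (2 * B / \<delta>)" by simp
  show ?thesis using that[OF 1 2 3] .
qed

lemma coord_box_bounded:
  assumes "\<forall>j<p. - B \<le> a j \<and> a j < b j \<and> b j \<le> B" "\<theta> \<in> coord_box p a b"
  shows "\<forall>j<p. \<bar>\<theta> j\<bar> \<le> B"
  using assms by (force simp: coord_box_def abs_le_iff)

text \<open>Guarantees that the Bochner integrals in the ELBO are genuine expectations rather than
  the default value 0.\<close>

lemma integrable_unif_prod:
  fixes \<phi> :: "(nat \<Rightarrow> real) \<Rightarrow> real"
  assumes ab: "\<forall>j<p. - B \<le> a j \<and> a j < b j \<and> b j \<le> B" and B: "B > 0"
    and [measurable]: "\<phi> \<in> borel_measurable (PiM {..<p} (\<lambda>_. borel))"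
    and bound: "\<And>\<theta>. \<theta> \<in> coord_box p a b \<Longrightarrow> \<bar>\<phi> \<theta>\<bar> \<le> R"
  shows "integrable (unif_prod p a b) \<phi>"
proof -
  interpret prob_space "unif_prod p a b" using ab by (intro prob_space_unif_prod) auto
  have "AE \<theta> in unif_prod p a b. norm (\<phi> \<theta>) \<le> R"
    using AE_unif_prod_coord_box[OF ab B] by eventually_elim (use bound in auto)
  then show ?thesis by (intro integrable_const_bound) auto
qed

text \<open>Restricting the prior to the box loses only the prior mass
  \<open>exp (- log_ratio p B a b)\<close>. A value that is nearly constant on a box is thus
  controlled by one prior integral.\<close>

lemma exp_le_nn_integral_prior:
  assumes ab: "\<forall>j<p. - B \<le> a j \<and> a j < b j \<and> b j \<le> B" and B: "B > 0"
    and [measurable]: "\<phi> \<in> borel_measurable (PiM {..<p} (\<lambda>_. borel))"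
    and lower: "\<And>\<theta>. \<theta> \<in> coord_box p a b \<Longrightarrow> c \<le> \<phi> \<theta>"
  shows "ennreal (exp c) \<le> ennreal (exp (log_ratio p B a b))
      * (\<integral>\<^sup>+\<theta>. ennreal (exp (\<phi> \<theta>)) \<partial>unif_prod p (\<lambda>_. - B) (\<lambda>_. B))"
proof -
  interpret prob_space "unif_prod p a b" using ab by (intro prob_space_unif_prod) auto
  have "ennreal (exp c) = (\<integral>\<^sup>+\<theta>. ennreal (exp c) \<partial>unif_prod p a b)"
    by (simp add: emeasure_space_1)
  also have "\<dots> \<le> (\<integral>\<^sup>+\<theta>. ennreal (exp (\<phi> \<theta>)) \<partial>unif_prod p a b)"
  proof (rule nn_integral_mono_AE)
    show "AE \<theta> in unif_prod p a b. ennreal (exp c) \<le> ennreal (exp (\<phi> \<theta>))"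
      using AE_unif_prod_coord_box[OF ab B] by eventually_elim (use lower in auto)
  qed
  also have "\<dots> = ennreal (exp (log_ratio p B a b)) * (\<integral>\<^sup>+\<theta>. indicator (coord_box p a b) \<theta>
      * ennreal (exp (\<phi> \<theta>)) \<partial>unif_prod p (\<lambda>_. - B) (\<lambda>_. B))"
    by (rule nn_integral_unif_prod[OF ab B]) measurable
  also have "\<dots> \<le> ennreal (exp (log_ratio p B a b))
      * (\<integral>\<^sup>+\<theta>. ennreal (exp (\<phi> \<theta>)) \<partial>unif_prod p (\<lambda>_. - B) (\<lambda>_. B))"
    by (intro mult_left_mono nn_integral_mono) (auto simp: indicator_def)
  finally show ?thesis .
qed

text \<open>One half of the Gibbs variational principle: expectation minus KL divergence never
  exceeds the logarithm of the exponential prior integral.\<close>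

lemma exp_integral_le_nn_integral_prior:
  assumes ab: "\<forall>j<p. - B \<le> a j \<and> a j < b j \<and> b j \<le> B" and B: "B > 0"
    and [measurable]: "\<phi> \<in> borel_measurable (PiM {..<p} (\<lambda>_. borel))"
    and bound: "\<And>\<theta>. \<theta> \<in> coord_box p a b \<Longrightarrow> \<bar>\<phi> \<theta>\<bar> \<le> R"
  shows "ennreal (exp ((\<integral>\<theta>. \<phi> \<theta> \<partial>unif_prod p a b) - log_ratio p B a b))
      \<le> (\<integral>\<^sup>+\<theta>. ennreal (exp (\<phi> \<theta>)) \<partial>unif_prod p (\<lambda>_. - B) (\<lambda>_. B))"
proof -
  let ?Q = "unif_prod p a b" and ?P = "unif_prod p (\<lambda>_. - B) (\<lambda>_. B)" and ?k = "log_ratio p B a b"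
  interpret prob_space ?Q using ab by (intro prob_space_unif_prod) auto
  have int: "integrable ?Q \<phi>" by (rule integrable_unif_prod[OF ab B _ bound]) auto
  have inte: "integrable ?Q (\<lambda>\<theta>. exp (\<phi> \<theta>))"
  proof (rule integrable_unif_prod[OF ab B])
    show "\<bar>exp (\<phi> \<theta>)\<bar> \<le> exp R" if "\<theta> \<in> coord_box p a b" for \<theta> using bound[OF that] by simp
  qed measurable
  \<comment> \<open>Jensen's inequality via the tangent of \<open>exp\<close> at the mean\<close>
  define m where "m = (\<integral>\<theta>. \<phi> \<theta> \<partial>?Q)"
  have "exp m = (\<integral>\<theta>. exp m * (1 + (\<phi> \<theta> - m)) \<partial>?Q)"
    using int by (simp add: prob_space m_def)
  also have "\<dots> \<le> (\<integral>\<theta>. exp (\<phi> \<theta>) \<partial>?Q)"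
  proof (rule integral_mono)
    show "exp m * (1 + (\<phi> \<theta> - m)) \<le> exp (\<phi> \<theta>)" for \<theta>
      using mult_left_mono[OF exp_ge_add_one_self[of "\<phi> \<theta> - m"], of "exp m"]
      by (simp add: mult_exp_exp)
  qed (use int inte in auto)
  finally have "ennreal (exp m) \<le> (\<integral>\<^sup>+\<theta>. ennreal (exp (\<phi> \<theta>)) \<partial>?Q)"
    using inte by (subst nn_integral_eq_integral) (auto simp: ennreal_leI)
  also have "\<dots> = ennreal (exp ?k) * (\<integral>\<^sup>+\<theta>. indicator (coord_box p a b) \<theta> * ennreal (exp (\<phi> \<theta>)) \<partial>?P)"
    by (rule nn_integral_unif_prod[OF ab B]) measurable
  also have "\<dots> \<le> ennreal (exp ?k) * (\<integral>\<^sup>+\<theta>. ennreal (exp (\<phi> \<theta>)) \<partial>?P)"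
    by (intro mult_left_mono nn_integral_mono) (auto simp: indicator_def)
  finally have "ennreal (exp (- ?k)) * ennreal (exp m)
      \<le> ennreal (exp (- ?k)) * (ennreal (exp ?k) * (\<integral>\<^sup>+\<theta>. ennreal (exp (\<phi> \<theta>)) \<partial>?P))"
    by (rule mult_left_mono) simp
  then show ?thesis
    by (simp add: mult.assoc[symmetric] ennreal_mult'[symmetric] mult_exp_exp m_def)
qed

text \<open>One architecture, one sample size and one fixed data vector: the arguments inside are
  deterministic, and randomness enters through hypotheses on the noise and on
  \<open>evidence\<close>.\<close>

locale nn_model =
  fixes d K M n :: nat and B :: real and xs :: "nat \<Rightarrow> nat \<Rightarrow> real"
    and f :: "(nat \<Rightarrow> real) \<Rightarrow> real" and Y :: "nat \<Rightarrow> real"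
  assumes d: "d \<ge> 1" and K: "K \<ge> 1" and M: "M \<ge> 1" and B: "B \<ge> 1" and n: "n \<ge> 2"
    and xs: "\<And>i. xs i \<in> cube d"
begin

abbreviation "p \<equiv> pdim d K M"
abbreviation "z i \<equiv> Y i - f (xs i)"
abbreviation "g \<theta> i \<equiv> net d K M \<theta> (xs i) - f (xs i)"
abbreviation "sq \<theta> \<equiv> (\<Sum>i\<in>{1..n}. (g \<theta> i)\<^sup>2)"
definition "Q = B * (real (d * M) + 1)"

text \<open>Moving all parameters by at most \<open>mesh\<close> changes the network by at most \<open>1 / n\<^sup>2\<close> on the cube.\<close>

definition "mesh = 1 / (real n ^ 2 * real K * Q ^ K)"
text \<open>An upper bound for minus the log prior mass of a box of radius \<open>mesh\<close>
  around any admissible parameter; it acts as a metric entropy.\<close>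

definition "cost = real p * ln (2 * B / mesh)"

lemma Q1: "Q \<ge> 1" unfolding Q_def by (rule Q_ge(2)[OF d K M B])

lemma mesh: "0 < mesh" "mesh \<le> B" "mesh * K * Q ^ K = 1 / real n ^ 2"
proof -
  have pos: "1 \<le> real n ^ 2" "1 \<le> real K" "1 \<le> Q ^ K" using n K Q1 one_le_power[OF Q1] by auto
  then have "1 * 1 \<le> real n ^ 2 * real K" by (intro mult_mono) auto
  then have "1 * 1 \<le> (real n ^ 2 * real K) * Q ^ K" using pos by (intro mult_mono) auto
  then have "1 \<le> real n ^ 2 * real K * Q ^ K" by simp
  then have "0 < mesh" "mesh \<le> 1" by (auto simp: mesh_def)
  then show "0 < mesh" "mesh \<le> B" using B by auto
  show "mesh * K * Q ^ K = 1 / real n ^ 2" using K Q1 by (simp add: mesh_def)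
qed

lemma g_close:
  assumes "\<forall>j<p. \<bar>\<theta> j\<bar> \<le> B" "\<forall>j<p. \<bar>\<theta>' j\<bar> \<le> B" "\<forall>j<p. \<bar>\<theta>' j - \<theta> j\<bar> \<le> mesh"
  shows "\<bar>g \<theta>' i - g \<theta> i\<bar> \<le> 1 / real n ^ 2"
  using abs_net_diff_le[OF d K M B assms less_imp_le[OF mesh(1)] xs, of i] mesh(3)
  unfolding Q_def by simp

text \<open>\<open>llr_perturb\<close> with \<eta> = 1 / n^2 and Z = 2 n: the noise term is (2 n +
  1) / n \<le> 3, and \<eta> / 2 \<le> 1 / 8 because n \<ge> 2.\<close>

lemma llr_close:
  assumes z: "\<And>i. i \<in> {1..n} \<Longrightarrow> \<bar>z i\<bar> \<le> 2 * real n"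
    and close: "\<And>i. i \<in> {1..n} \<Longrightarrow> \<bar>v' i - v i\<bar> \<le> 1 / real n ^ 2"
  shows "llr n z v - 3 - (\<Sum>i\<in>{1..n}. (v i)\<^sup>2) / 8 \<le> llr n z v'"
proof -
  let ?S = "\<Sum>i\<in>{1..n}. (v i)\<^sup>2"
  have n2: "4 \<le> real n ^ 2" using power_mono[of 2 "real n" 2] n by simp
  have S: "0 \<le> ?S" by (intro sum_nonneg) simp
  have "llr n z v - n * (1 / real n ^ 2) * (2 * real n + 1) - (1 / real n ^ 2) / 2 * ?S \<le> llr n z v'"
    using n2 by (intro llr_perturb[OF z close]) (auto simp: divide_le_eq)
  moreover have "n * (1 / real n ^ 2) * (2 * real n + 1) \<le> 3"
    using n by (simp add: power2_eq_square field_simps)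
  moreover have "(1 / real n ^ 2) / 2 * ?S \<le> 1 / 8 * ?S"
    using n2 S by (intro mult_right_mono) (auto simp: divide_le_eq)
  ultimately show ?thesis by linarith
qed

text \<open>The bound may depend on the data and on \<open>f\<close> in any way; it serves
  integrability only.\<close>

lemma abs_llr_le:
  obtains R where "\<And>\<theta>. \<forall>j<p. \<bar>\<theta> j\<bar> \<le> B \<Longrightarrow> \<bar>llr n z (g \<theta>)\<bar> \<le> R"
proof -
  define R where "R = (\<Sum>i\<in>{1..n}. \<bar>z i\<bar> * (Q ^ K + \<bar>f (xs i)\<bar>)) + (\<Sum>i\<in>{1..n}. (Q ^ K + \<bar>f (xs i)\<bar>)\<^sup>2) / 2"
  have "\<bar>llr n z (g \<theta>)\<bar> \<le> R" if th: "\<forall>j<p. \<bar>\<theta> j\<bar> \<le> B" for \<theta>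
  proof -
    have g: "\<bar>g \<theta> i\<bar> \<le> Q ^ K + \<bar>f (xs i)\<bar>" for i
      using abs_net_le[OF d K M B th xs[of i]] abs_triangle_ineq4[of "net d K M \<theta> (xs i)" "f (xs i)"]
      unfolding Q_def by linarith
    have "\<bar>\<Sum>i\<in>{1..n}. z i * g \<theta> i\<bar> \<le> (\<Sum>i\<in>{1..n}. \<bar>z i\<bar> * (Q ^ K + \<bar>f (xs i)\<bar>))"
      by (rule order_trans[OF sum_abs]) (auto simp: abs_mult intro!: sum_mono mult_left_mono g)
    moreover have "\<bar>sq \<theta>\<bar> \<le> (\<Sum>i\<in>{1..n}. (Q ^ K + \<bar>f (xs i)\<bar>)\<^sup>2)"
      by (rule order_trans[OF sum_abs]) (auto intro!: sum_mono order_trans[OF g abs_ge_self] simp: abs_le_square_iff[symmetric])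
    ultimately show ?thesis unfolding llr_def R_def by linarith
  qed
  then show thesis by (rule that)
qed

lemma ELBO_eq:
  assumes ab: "\<forall>j<p. - B \<le> a j \<and> a j < b j \<and> b j \<le> B"
  shows "ELBO d xs n K M Y (unif_prod p a b) (prior_KM d K M B)
    = - log_norm n z - ((\<integral>\<theta>. llr n z (g \<theta>) \<partial>unif_prod p a b) - log_ratio p B a b)"
proof -
  have B': "B > 0" using B by simp
  interpret prob_space "unif_prod p a b" using ab by (intro prob_space_unif_prod) auto
  obtain R where R: "\<And>\<theta>. \<forall>j<p. \<bar>\<theta> j\<bar> \<le> B \<Longrightarrow> \<bar>llr n z (g \<theta>)\<bar> \<le> R" using abs_llr_le by blast
  have int: "integrable (unif_prod p a b) (\<lambda>\<theta>. llr n z (g \<theta>))"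
    using borel_measurable_llr_snd[where c = 1]
    by (intro integrable_unif_prod[OF ab B' _ R] coord_box_bounded[OF ab]) auto
  show ?thesis
    unfolding ELBO_def prior_KM_def KL_unif_prod[OF ab B'] ln_lik[where f = f]
    using int by (simp add: prob_space)
qed

text \<open>The Gibbs inequality for the log-likelihood ratio. The bound is free of
  \<open>cost\<close>, so it stays useful for architectures whose cost far exceeds
  \<open>t\<close>.\<close>

lemma ELBO_lower:
  assumes "\<Xi> \<in> Vfam d K M B" and ev: "evidence d xs n f 1 K M B Y \<le> ennreal (exp t)"
  shows "- ELBO d xs n K M Y \<Xi> (prior_KM d K M B) \<le> log_norm n z + t"
proof -
  obtain a b where X: "\<Xi> = unif_prod p a b" and ab: "\<forall>j<p. - B \<le> a j \<and> a j < b j \<and> b j \<le> B"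
    using assms(1) by (auto simp: Vfam_def)
  have B': "B > 0" using B by simp
  obtain R where R: "\<And>\<theta>. \<forall>j<p. \<bar>\<theta> j\<bar> \<le> B \<Longrightarrow> \<bar>llr n z (g \<theta>)\<bar> \<le> R" using abs_llr_le by blast
  have "ennreal (exp ((\<integral>\<theta>. llr n z (g \<theta>) \<partial>unif_prod p a b) - log_ratio p B a b))
      \<le> (\<integral>\<^sup>+\<theta>. ennreal (exp (llr n z (g \<theta>))) \<partial>unif_prod p (\<lambda>_. - B) (\<lambda>_. B))"
    using borel_measurable_llr_snd[where c = 1]
    by (intro exp_integral_le_nn_integral_prior[OF ab B' _ R] coord_box_bounded[OF ab]) auto
  also have "\<dots> \<le> ennreal (exp t)" using ev by (simp add: evidence_def prior_KM_def)
  finally have "(\<integral>\<theta>. llr n z (g \<theta>) \<partial>unif_prod p a b) - log_ratio p B a b \<le> t" by simp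
  then show ?thesis unfolding X ELBO_eq[OF ab] by simp
qed

text \<open>The evidence at \<open>c = 1 / 2\<close> dominates its part on the box around \<theta>,
  so llr(g/2) is at most 3 + sq/32 + cost + t. Doubling and using llr(g) = 2 llr(g/2) - sq/4 leaves
  -3 sq/16, more than the required -sq/8.\<close>

lemma llr_upper:
  assumes th: "\<forall>j<p. \<bar>\<theta> j\<bar> \<le> B" and ev: "evidence d xs n f (1 / 2) K M B Y \<le> ennreal (exp t)"
    and z: "\<And>i. i \<in> {1..n} \<Longrightarrow> \<bar>z i\<bar> \<le> 2 * real n"
  shows "llr n z (g \<theta>) \<le> 6 + 2 * cost + 2 * t - sq \<theta> / 8"
proof -
  have B': "B > 0" using B by simp
  obtain a b where ab: "\<forall>j<p. - B \<le> a j \<and> a j < b j \<and> b j \<le> B"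
    and near: "\<And>\<theta>'. \<theta>' \<in> coord_box p a b \<Longrightarrow> \<forall>j<p. \<bar>\<theta>' j - \<theta> j\<bar> \<le> mesh"
    and lr: "log_ratio p B a b \<le> cost"
    using coord_box_around[OF th mesh(1,2)] unfolding cost_def by metis
  \<comment> \<open>halving \<open>g\<close> leaves \<open>- sq \<theta> / 4\<close> to spare, of which the perturbation error uses up one half at most\<close>
  let ?c = "llr n z (\<lambda>i. (1 / 2) * g \<theta> i) - 3 - sq \<theta> / 32"
  have "ennreal (exp ?c) \<le> ennreal (exp (log_ratio p B a b))
      * (\<integral>\<^sup>+\<theta>. ennreal (exp (llr n z (\<lambda>i. (1 / 2) * g \<theta> i))) \<partial>unif_prod p (\<lambda>_. - B) (\<lambda>_. B))"
  proof (rule exp_le_nn_integral_prior[OF ab B'])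
    fix \<theta>' assume \<theta>': "\<theta>' \<in> coord_box p a b"
    have "\<bar>g \<theta>' i - g \<theta> i\<bar> \<le> 1 / real n ^ 2" for i
      by (intro g_close th near \<theta>' coord_box_bounded[OF ab])
    moreover have "\<bar>(1 / 2) * g \<theta>' i - (1 / 2) * g \<theta> i\<bar> \<le> \<bar>g \<theta>' i - g \<theta> i\<bar>" for i
      unfolding right_diff_distrib[symmetric] abs_mult by simp
    ultimately have "\<bar>(1 / 2) * g \<theta>' i - (1 / 2) * g \<theta> i\<bar> \<le> 1 / real n ^ 2" for i
      using order_trans by blast
    from llr_close[OF z this]
    show "?c \<le> llr n z (\<lambda>i. (1 / 2) * g \<theta>' i)"
      by (simp add: power_mult_distrib power_divide sum_divide_distrib[symmetric])
  qed measurable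
  also have "\<dots> = ennreal (exp (log_ratio p B a b)) * evidence d xs n f (1 / 2) K M B Y"
    by (simp add: evidence_def prior_KM_def)
  also have "\<dots> \<le> ennreal (exp cost) * ennreal (exp t)"
    using lr ev by (intro mult_mono ennreal_leI) auto
  also have "\<dots> = ennreal (exp (cost + t))" by (simp add: exp_add ennreal_mult')
  finally have "?c \<le> cost + t" by simp
  moreover have "llr n z (g \<theta>) = 2 * llr n z (\<lambda>i. (1 / 2) * g \<theta> i) - sq \<theta> / 4"
    unfolding llr_scale by (simp add: llr_def power2_eq_square)
  moreover have "0 \<le> sq \<theta>" by (intro sum_nonneg) simp
  ultimately show ?thesis by linarith
qed

text \<open>Integrate \<open>llr_upper\<close>, using the quadratic gain on \<open>S\<close> and
  discarding it elsewhere; the KL term is nonnegative and is dropped.\<close>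

lemma ELBO_upper_mass:
  assumes "\<Xi> \<in> Vfam d K M B" and ev: "evidence d xs n f (1 / 2) K M B Y \<le> ennreal (exp t)"
    and z: "\<And>i. i \<in> {1..n} \<Longrightarrow> \<bar>z i\<bar> \<le> 2 * real n"
    and bad: "\<And>\<theta>. \<theta> \<in> S \<Longrightarrow> s \<le> sq \<theta>"
  shows "- ELBO d xs n K M Y \<Xi> (prior_KM d K M B) \<le> log_norm n z + 6 + 2 * cost + 2 * t - s / 8 * measure \<Xi> S"
proof -
  obtain a b where X: "\<Xi> = unif_prod p a b" and ab: "\<forall>j<p. - B \<le> a j \<and> a j < b j \<and> b j \<le> B"
    using assms(1) by (auto simp: Vfam_def)
  have B': "B > 0" using B by simp
  interpret prob_space "unif_prod p a b" using ab by (intro prob_space_unif_prod) auto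
  obtain R where R: "\<And>\<theta>. \<forall>j<p. \<bar>\<theta> j\<bar> \<le> B \<Longrightarrow> \<bar>llr n z (g \<theta>)\<bar> \<le> R" using abs_llr_le by blast
  have int: "integrable (unif_prod p a b) (\<lambda>\<theta>. llr n z (g \<theta>))"
    using borel_measurable_llr_snd[where c = 1]
    by (intro integrable_unif_prod[OF ab B' _ R] coord_box_bounded[OF ab]) auto
  let ?r = "6 + 2 * cost + 2 * t"
  have sq0: "0 \<le> sq \<theta>" for \<theta> by (intro sum_nonneg) simp
  \<comment> \<open>\<open>measure\<close> is 0 on non-measurable sets, so measurability of \<open>S\<close> is not an issue\<close>
  define S' where "S' = (if S \<in> sets (unif_prod p a b) then S else {})"
  have S': "S' \<in> sets (unif_prod p a b)" "measure (unif_prod p a b) S = measure (unif_prod p a b) S'" "S' \<subseteq> S"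
    by (auto simp: S'_def measure_notin_sets)
  have ind: "integrable (unif_prod p a b) (\<lambda>\<theta>. s / 8 * indicator S' \<theta>)"
    by (intro integrable_mult_right integrable_real_indicator S') (simp add: less_top[symmetric])
  have "(\<integral>\<theta>. llr n z (g \<theta>) \<partial>unif_prod p a b) \<le> (\<integral>\<theta>. ?r - s / 8 * indicator S' \<theta> \<partial>unif_prod p a b)"
  proof (rule integral_mono_AE[OF int])
    show "integrable (unif_prod p a b) (\<lambda>\<theta>. ?r - s / 8 * indicator S' \<theta>)" by (intro Bochner_Integration.integrable_diff integrable_const ind)
    show "AE \<theta> in unif_prod p a b. llr n z (g \<theta>) \<le> ?r - s / 8 * indicator S' \<theta>"
      using AE_unif_prod_coord_box[OF ab B']
    proof eventually_elim
      fix \<theta> assume "\<theta> \<in> coord_box p a b"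
      then have "llr n z (g \<theta>) \<le> ?r - sq \<theta> / 8"
        by (intro llr_upper coord_box_bounded[OF ab] ev z)
      moreover have "s \<le> sq \<theta>" if "\<theta> \<in> S'" using that S' bad by auto
      ultimately show "llr n z (g \<theta>) \<le> ?r - s / 8 * indicator S' \<theta>"
        using sq0[of \<theta>] by (cases "\<theta> \<in> S'") auto
    qed
  qed
  also have "\<dots> = ?r - s / 8 * measure (unif_prod p a b) S'"
    using S' by (subst Bochner_Integration.integral_diff[OF integrable_const ind]) (simp add: prob_space)
  finally show ?thesis
    unfolding X ELBO_eq[OF ab] S'(2) using log_ratio_nonneg[OF ab] by linarith
qed

text \<open>The competitor is the uniform law on the box of radius \<open>mesh\<close> around
  \<open>\<theta>\<close>, on which the log-likelihood ratio hardly changes and whose KL divergence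
  is at most \<open>cost\<close>.\<close>

lemma ELBO_min_upper:
  assumes th: "\<forall>j<p. \<bar>\<theta> j\<bar> \<le> B" and z: "\<And>i. i \<in> {1..n} \<Longrightarrow> \<bar>z i\<bar> \<le> 2 * real n"
  shows "\<exists>\<Xi>\<in>Vfam d K M B. ELBO d xs n K M Y \<Xi> (prior_KM d K M B)
      \<le> - log_norm n z - llr n z (g \<theta>) + 3 + sq \<theta> / 8 + cost"
proof -
  have B': "B > 0" using B by simp
  obtain a b where ab: "\<forall>j<p. - B \<le> a j \<and> a j < b j \<and> b j \<le> B"
    and near: "\<And>\<theta>'. \<theta>' \<in> coord_box p a b \<Longrightarrow> \<forall>j<p. \<bar>\<theta>' j - \<theta> j\<bar> \<le> mesh"
    and lr: "log_ratio p B a b \<le> cost"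
    using coord_box_around[OF th mesh(1,2)] unfolding cost_def by metis
  interpret prob_space "unif_prod p a b" using ab by (intro prob_space_unif_prod) auto
  obtain R where R: "\<And>\<theta>. \<forall>j<p. \<bar>\<theta> j\<bar> \<le> B \<Longrightarrow> \<bar>llr n z (g \<theta>)\<bar> \<le> R" using abs_llr_le by blast
  have int: "integrable (unif_prod p a b) (\<lambda>\<theta>. llr n z (g \<theta>))"
    using borel_measurable_llr_snd[where c = 1]
    by (intro integrable_unif_prod[OF ab B' _ R] coord_box_bounded[OF ab]) auto
  let ?c = "llr n z (g \<theta>) - 3 - sq \<theta> / 8"
  have "?c = (\<integral>\<theta>. ?c \<partial>unif_prod p a b)" by (simp add: prob_space)
  also have "\<dots> \<le> (\<integral>\<theta>. llr n z (g \<theta>) \<partial>unif_prod p a b)"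
  proof (rule integral_mono_AE[OF _ int])
    show "AE \<theta>' in unif_prod p a b. ?c \<le> llr n z (g \<theta>')"
      using AE_unif_prod_coord_box[OF ab B']
    proof eventually_elim
      fix \<theta>' assume \<theta>': "\<theta>' \<in> coord_box p a b"
      show "?c \<le> llr n z (g \<theta>')"
        by (intro llr_close z g_close th near \<theta>' coord_box_bounded[OF ab])
    qed
  qed simp
  finally show ?thesis
    using lr ab by (intro bexI[of _ "unif_prod p a b"]) (auto simp: ELBO_eq[OF ab] Vfam_def)
qed

end

section \<open>Mixtures of architectures\<close>

text \<open>The constant \<open>ln C\<close> is absorbed into a multiple of \<open>ln n\<close>
  because n \<ge> 2.\<close>

lemma ln_le_of_powr_bound:
  assumes "n \<ge> 2" "1 \<le> x" "x \<le> C * real n powr \<nu>"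
  shows "ln x \<le> (\<bar>ln C\<bar> / ln 2 + \<nu>) * ln (real n)"
proof -
  have np: "real n powr \<nu> > 0" using assms(1) by simp
  have "C * real n powr \<nu> > 0" using assms by linarith
  then have C: "C > 0" using np by (simp add: zero_less_mult_iff)
  have "ln x \<le> ln (C * real n powr \<nu>)" using assms by simp
  also have "\<dots> = ln C + \<nu> * ln (real n)" using C assms(1) by (simp add: ln_mult ln_powr)
  also have "ln C \<le> \<bar>ln C\<bar> / ln 2 * ln 2" by simp
  also have "\<dots> \<le> \<bar>ln C\<bar> / ln 2 * ln (real n)" using assms(1) by (intro mult_left_mono) auto
  finally show ?thesis by (simp add: algebra_simps)
qed

text \<open>The factor \<open>2 * real d\<close> comes from \<open>pdim_le\<close>; the bracket
  bounds \<open>ln (2 * B / mesh)\<close> divided by K log n. In it, 3 stems from the factors 2 and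
  n^2, the second term from \<open>B\<close> (directly and in \<open>Q\<close>), the third from
  \<open>K\<close> and from \<open>M\<close> in \<open>Q\<close>, and the last from
  \<open>2 * d\<close> in \<open>Q\<close>.\<close>

definition cost_const :: "nat \<Rightarrow> real \<Rightarrow> real \<Rightarrow> real \<Rightarrow> real" where
  "cost_const d C\<^sub>B \<nu> C\<^sub>S = 2 * real d * (3 + 2 * (\<bar>ln C\<^sub>B\<bar> / ln 2 + \<nu>) + 2 * (\<bar>ln C\<^sub>S\<bar> / ln 2 + 1) + ln (2 * real d) / ln 2)"

context nn_model
begin

text \<open>There are O(K M^2) parameters, each costing O(K log n) because the Lipschitz constant is
  exponential in the depth. The product has exactly the order of the exponent in
  \<open>alpha\<close>.\<close>

lemma cost_le:
  assumes BC: "B \<le> C\<^sub>B * real n powr \<nu>" and KC: "real K \<le> C\<^sub>S * real n" and MC: "real M \<le> C\<^sub>S * real n"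
    and nu: "\<nu> \<ge> 0"
  shows "cost \<le> cost_const d C\<^sub>B \<nu> C\<^sub>S * (real (K * M))\<^sup>2 * ln (real n)"
proof -
  let ?L = "ln (real n)"
  define \<beta> where "\<beta> = \<bar>ln C\<^sub>B\<bar> / ln 2 + \<nu>"
  define \<sigma> where "\<sigma> = \<bar>ln C\<^sub>S\<bar> / ln 2 + 1"
  define \<tau> where "\<tau> = ln (2 * real d) / ln 2"
  have L2: "ln 2 \<le> ?L" using n by simp
  have L0: "0 < ?L" using n by simp
  have nonneg: "\<beta> \<ge> 0" "\<sigma> \<ge> 0" "\<tau> \<ge> 0" unfolding \<beta>_def \<sigma>_def \<tau>_def using nu d by auto
  have lnB: "ln B \<le> \<beta> * ?L" unfolding \<beta>_def by (rule ln_le_of_powr_bound[OF n B BC])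
  have lnK: "ln (real K) \<le> \<sigma> * ?L" and lnM: "ln (real M) \<le> \<sigma> * ?L"
    unfolding \<sigma>_def using K M KC MC n by (auto intro!: ln_le_of_powr_bound)
  have lnd: "ln (2 * real d) \<le> \<tau> * ?L"
  proof -
    have "ln (2 * real d) = \<tau> * ln 2" by (simp add: \<tau>_def)
    also have "\<dots> \<le> \<tau> * ?L" using L2 nonneg by (intro mult_left_mono)
    finally show ?thesis .
  qed
  have lnQ: "ln Q \<le> (\<beta> + \<tau> + \<sigma>) * ?L"
  proof -
    have "1 * 1 \<le> d * M" using d M by (intro mult_le_mono)
    then have dM: "1 \<le> real (d * M)" by linarith
    have "ln Q = ln B + ln (real (d * M) + 1)" unfolding Q_def using B dM by (subst ln_mult) auto
    also have "ln (real (d * M) + 1) \<le> ln (2 * real d * real M)"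
      using dM by (intro ln_mono) (auto simp: mult.commute add_pos_nonneg)
    also have "\<dots> = ln (2 * real d) + ln (real M)" using d M by (subst ln_mult) auto
    finally show ?thesis using lnB lnd lnM by (simp add: algebra_simps)
  qed
  have "2 * B / mesh = 2 * (B * (real n ^ 2 * (real K * Q ^ K)))" by (simp add: mesh_def)
  then have "ln (2 * B / mesh) = ln 2 + (ln B + (2 * ?L + (ln (real K) + K * ln Q)))"
    using B n K Q1 by (simp add: ln_mult ln_realpow)
  also have "\<dots> \<le> ?L + (\<beta> * ?L + (2 * ?L + (\<sigma> * ?L + K * ((\<beta> + \<tau> + \<sigma>) * ?L))))"
    using L2 lnB lnK lnQ by (intro add_mono mult_left_mono) auto
  also have "\<dots> = 1 * ((3 + \<beta> + \<sigma>) * ?L) + K * ((\<beta> + \<tau> + \<sigma>) * ?L)" by (simp add: algebra_simps)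
  also have "\<dots> \<le> K * ((3 + \<beta> + \<sigma>) * ?L) + K * ((\<beta> + \<tau> + \<sigma>) * ?L)"
    using K L0 nonneg by (intro add_mono mult_right_mono) auto
  also have "\<dots> = K * ((3 + 2 * \<beta> + 2 * \<sigma> + \<tau>) * ?L)" by (simp add: algebra_simps)
  finally have ln_le: "ln (2 * B / mesh) \<le> K * ((3 + 2 * \<beta> + 2 * \<sigma> + \<tau>) * ?L)" .
  have "cost \<le> real p * (K * ((3 + 2 * \<beta> + 2 * \<sigma> + \<tau>) * ?L))"
    unfolding cost_def using ln_le by (intro mult_left_mono) auto
  also have "\<dots> \<le> real (2 * d * K * M\<^sup>2) * (K * ((3 + 2 * \<beta> + 2 * \<sigma> + \<tau>) * ?L))"
    using L0 nonneg by (intro mult_right_mono of_nat_mono pdim_le d M) auto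
  also have "\<dots> = cost_const d C\<^sub>B \<nu> C\<^sub>S * (real (K * M))\<^sup>2 * ?L"
    by (simp add: cost_const_def \<beta>_def \<sigma>_def \<tau>_def power2_eq_square mult_ac)
  finally show ?thesis .
qed

end

lemma cost_const_nonneg: "d \<ge> 1 \<Longrightarrow> \<nu> \<ge> 0 \<Longrightarrow> cost_const d C\<^sub>B \<nu> C\<^sub>S \<ge> 0"
  unfolding cost_const_def by (intro mult_nonneg_nonneg add_nonneg_nonneg) auto

lemma measure_Vfam_le_1:
  assumes "\<Xi> \<in> Vfam d K M B"
  shows "measure \<Xi> S \<le> 1"
proof -
  obtain a b where X: "\<Xi> = unif_prod (pdim d K M) a b" and "\<forall>j<pdim d K M. a j < b j"
    using assms by (auto simp: Vfam_def)
  then interpret prob_space \<Xi> by (auto intro: prob_space_unif_prod)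
  show ?thesis by simp
qed

section \<open>Prior and posterior weights of the architectures\<close>

lemma alpha_pos:
  assumes "finite Ms" "KM \<in> Ms"
  shows "0 < alpha b0 Ms n KM"
  unfolding alpha_def using assms by (intro divide_pos_pos sum_pos) auto

lemma alpha_ratio:
  assumes "finite Ms" "KM \<in> Ms" "KM' \<in> Ms"
  shows "alpha b0 Ms n KM = alpha b0 Ms n KM' * exp (b0 * ((real (fst KM' * snd KM'))\<^sup>2 - (real (fst KM * snd KM))\<^sup>2) * ln (real n))"
proof -
  let ?e = "\<lambda>KM. - b0 * (real (fst KM * snd KM))\<^sup>2 * ln (real n)"
  have "?e KM = ?e KM' + b0 * ((real (fst KM' * snd KM'))\<^sup>2 - (real (fst KM * snd KM))\<^sup>2) * ln (real n)"
    by (simp add: algebra_simps)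
  then have "exp (?e KM) = exp (?e KM') * exp (b0 * ((real (fst KM' * snd KM'))\<^sup>2 - (real (fst KM * snd KM))\<^sup>2) * ln (real n))"
    by (simp only: exp_add)
  then show ?thesis unfolding alpha_def by simp
qed

lemma
  assumes fin: "finite Ms" and "Ms \<noteq> {}"
  shows gamma_hat_nonneg: "KM \<in> Ms \<Longrightarrow> 0 \<le> gamma_hat d xs b0 Ms B n Xi Y KM"
    and sum_gamma_hat: "(\<Sum>KM\<in>Ms. gamma_hat d xs b0 Ms B n Xi Y KM) = 1"
proof -
  let ?w = "\<lambda>KM. alpha b0 Ms n KM * exp (- ELBO d xs n (fst KM) (snd KM) Y (Xi KM) (prior_KM d (fst KM) (snd KM) B))"
  have w: "0 < ?w KM" if "KM \<in> Ms" for KM using alpha_pos[OF fin that] by simp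
  then have W: "0 < (\<Sum>KM\<in>Ms. ?w KM)" using assms by (intro sum_pos)
  show "0 \<le> gamma_hat d xs b0 Ms B n Xi Y KM" if "KM \<in> Ms"
    unfolding gamma_hat_def Let_def using w[OF that] W by (simp add: less_imp_le)
  show "(\<Sum>KM\<in>Ms. gamma_hat d xs b0 Ms B n Xi Y KM) = 1"
    unfolding gamma_hat_def Let_def sum_divide_distrib[symmetric] using W by simp
qed

text \<open>The normalising sum is at least its single term at \<open>KM'\<close>. In the quotient
  the normalisation of \<open>alpha\<close> and the common part \<open>c\<close> cancel.\<close>

lemma gamma_hat_le:
  assumes fin: "finite Ms" and KM: "KM \<in> Ms" "KM' \<in> Ms"
    and E: "- ELBO d xs n (fst KM) (snd KM) Y (Xi KM) (prior_KM d (fst KM) (snd KM) B) \<le> c + u"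
    and E': "c - v \<le> - ELBO d xs n (fst KM') (snd KM') Y (Xi KM') (prior_KM d (fst KM') (snd KM') B)"
  shows "gamma_hat d xs b0 Ms B n Xi Y KM
    \<le> exp (b0 * ((real (fst KM' * snd KM'))\<^sup>2 - (real (fst KM * snd KM))\<^sup>2) * ln (real n) + u + v)"
proof -
  let ?w = "\<lambda>KM. alpha b0 Ms n KM * exp (- ELBO d xs n (fst KM) (snd KM) Y (Xi KM) (prior_KM d (fst KM) (snd KM) B))"
  let ?r = "b0 * ((real (fst KM' * snd KM'))\<^sup>2 - (real (fst KM * snd KM))\<^sup>2) * ln (real n)"
  have w: "0 < ?w KM" if "KM \<in> Ms" for KM using alpha_pos[OF fin that] by simp
  have "?w KM' \<le> (\<Sum>KM\<in>Ms. ?w KM)"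
    using KM w by (intro member_le_sum fin) (auto simp: less_imp_le)
  then have "gamma_hat d xs b0 Ms B n Xi Y KM \<le> ?w KM / ?w KM'"
    unfolding gamma_hat_def Let_def using w[OF KM(1)] w[OF KM(2)]
    by (intro divide_left_mono) (auto simp: less_imp_le)
  also have "\<dots> \<le> exp (?r + u + v)"
  proof -
    have "?w KM \<le> (alpha b0 Ms n KM' * exp ?r) * exp (c + u)"
      unfolding alpha_ratio[OF fin KM] using E alpha_pos[OF fin KM(2)]
      by (intro mult_left_mono) (auto simp: less_imp_le)
    also have "\<dots> = alpha b0 Ms n KM' * exp (c - v) * exp (?r + u + v)"
      by (simp add: mult.assoc mult_exp_exp algebra_simps)
    also have "\<dots> \<le> ?w KM' * exp (?r + u + v)"
      using E' alpha_pos[OF fin KM(2), of b0 n] by (intro mult_right_mono mult_left_mono) auto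
    finally show ?thesis using w[OF KM(2)] by (simp add: divide_le_eq mult.commute)
  qed
  finally show ?thesis .
qed

text \<open>The coefficient of \<open>N\<close> in the exponent of the weight bound for an
  architecture of moderate size, before the gain from its bad mass is subtracted.\<close>

definition mass_const :: "real \<Rightarrow> real \<Rightarrow> real \<Rightarrow> real" where
  "mass_const b0 m C = 4 * b0 + (m + 8 + 4 * C) + 6 + 2 * C * ((4 * b0 + (m + 8 + 4 * C) + 2 * m) / b0) + 2 * m"

text \<open>Here \<open>\<gamma>\<close> is the weight of an architecture, \<open>\<rho>\<close> its
  bad mass, \<open>D\<close> its complexity (K M)^2 log n and \<open>U\<close> its centred negative
  ELBO. Either the weight is exponentially small or the bad mass is of order 1 / a^2.\<close>

lemma mass_dichotomy:
  fixes \<gamma> \<rho> D N m C b0 a U :: real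
  assumes gam: "0 \<le> \<gamma>" "\<gamma> \<le> exp (4 * b0 * N - b0 * D + U + (m + 8 + 4 * C) * N)" and rho: "0 \<le> \<rho>" "\<rho> \<le> 1"
    and U1: "U \<le> m * N" and U2: "U \<le> 6 + 2 * (C * D) + 2 * (m * N) - a\<^sup>2 * N / 8 * \<rho>"
    and pos: "b0 > 0" "N \<ge> 1" "C \<ge> 0" "a > 0" "m \<ge> 0" "D \<ge> 0"
  shows "\<gamma> * \<rho> \<le> exp (- (m * N)) + \<gamma> * (8 * (mass_const b0 m C + m) / a\<^sup>2)"
proof -
  \<comment> \<open>Chosen so that b0 D \<ge> T N makes the exponent at most -m N: one
    \<open>m\<close> pays for \<open>U \<le> m * N\<close>, the other is the target.\<close>
  define T where "T = 4 * b0 + (m + 8 + 4 * C) + 2 * m"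
  define C3 where "C3 = mass_const b0 m C"
  have C3: "C3 = 4 * b0 + (m + 8 + 4 * C) + 6 + 2 * C * (T / b0) + 2 * m"
    by (simp add: C3_def mass_const_def T_def)
  have T0: "T \<ge> 0" using pos by (simp add: T_def)
  have C30: "C3 \<ge> 0" unfolding C3 using pos T0 by (intro add_nonneg_nonneg) auto
  have tiny: "\<gamma> * \<rho> \<le> exp (- (m * N)) + \<gamma> * (8 * (C3 + m) / a\<^sup>2)" if "\<gamma> \<le> exp (- (m * N))"
  proof -
    have "\<gamma> * \<rho> \<le> exp (- (m * N)) * 1" using that gam rho by (intro mult_mono) auto
    moreover have "0 \<le> \<gamma> * (8 * (C3 + m) / a\<^sup>2)" using gam C30 pos by auto
    ultimately show ?thesis by linarith
  qed
  have "\<gamma> * \<rho> \<le> exp (- (m * N)) + \<gamma> * (8 * (C3 + m) / a\<^sup>2)"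
  proof (cases "T * N \<le> b0 * D")
    \<comment> \<open>Large architecture: the prior penalty b0 D outweighs everything else,
      including \<open>U\<close>.\<close>
    case True
    then have "4 * b0 * N - b0 * D + U + (m + 8 + 4 * C) * N \<le> - (m * N)"
      using U1 by (simp add: T_def algebra_simps)
    then show ?thesis using gam by (intro tiny) (auto intro: order_trans)
  next
    case False
    then have D: "D \<le> T / b0 * N" using pos by (simp add: field_simps)
    have "C * D \<le> C * (T / b0 * N)" using D pos by (intro mult_left_mono)
    moreover have "0 \<le> b0 * D" using pos by simp
    moreover have "(C3 - a\<^sup>2 * \<rho> / 8) * N = 4 * b0 * N + (m + 8 + 4 * C) * N + 6 * N
        + 2 * (C * (T / b0 * N)) + 2 * (m * N) - a\<^sup>2 * N / 8 * \<rho>"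
      unfolding C3 by (simp add: algebra_simps)
    ultimately have ex: "4 * b0 * N - b0 * D + U + (m + 8 + 4 * C) * N \<le> (C3 - a\<^sup>2 * \<rho> / 8) * N"
      using U2 pos(2) by linarith
    show ?thesis
    proof (cases "8 * (C3 + m) \<le> a\<^sup>2 * \<rho>")
      \<comment> \<open>Moderate architecture with much bad mass: the quadratic gain a^2 \<rho> / 8
        makes the exponent at most -m N.\<close>
      case True
      then have "(C3 - a\<^sup>2 * \<rho> / 8) * N \<le> (- m) * N" using pos by (intro mult_right_mono) auto
      then show ?thesis using gam ex by (intro tiny) (auto intro: order_trans)
    next
      case False
      then have "\<rho> \<le> 8 * (C3 + m) / a\<^sup>2" using pos by (simp add: field_simps)
      then have "\<gamma> * \<rho> \<le> \<gamma> * (8 * (C3 + m) / a\<^sup>2)" using gam by (intro mult_left_mono)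
      then show ?thesis using exp_ge_zero[of "- (m * N)"] by linarith
    qed
  qed
  then show ?thesis by (simp add: C3_def)
qed

text \<open>Sum \<open>mass_dichotomy\<close> over the architectures. As the weights add up to 1,
  the cardinality multiplies only the exponentially small term.\<close>

lemma post_mass_le:
  fixes f :: "(nat \<Rightarrow> real) \<Rightarrow> real"
  assumes fin: "finite Ms" and Ms: "Ms \<subseteq> {KM. fst KM \<ge> 2 \<and> snd KM \<ge> 1}"
    and d: "d \<ge> 1" and B: "B \<ge> 1" and n: "n \<ge> 2" and xs: "\<And>i. xs i \<in> cube d"
    and Xi: "\<And>KM. KM \<in> Ms \<Longrightarrow> Xi KM \<in> Vfam d (fst KM) (snd KM) B \<and>
          (\<forall>\<Xi>\<in>Vfam d (fst KM) (snd KM) B.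
             ELBO d xs n (fst KM) (snd KM) Y (Xi KM) (prior_KM d (fst KM) (snd KM) B)
             \<le> ELBO d xs n (fst KM) (snd KM) Y \<Xi> (prior_KM d (fst KM) (snd KM) B))"
    and cost: "\<And>KM. KM \<in> Ms \<Longrightarrow> nn_model.cost d (fst KM) (snd KM) n B
          \<le> C * (real (fst KM * snd KM))\<^sup>2 * ln (real n)"
    and pos: "b0 > 0" "C \<ge> 0" "a > 0" "m \<ge> 0" "N \<ge> 1"
    and K0: "(K\<^sub>0, M\<^sub>0) \<in> Ms" "(real (K\<^sub>0 * M\<^sub>0))\<^sup>2 * ln (real n) \<le> 4 * N"
    and th0: "\<forall>j<pdim d K\<^sub>0 M\<^sub>0. \<bar>\<theta>\<^sub>0 j\<bar> \<le> B" "(\<Sum>i\<in>{1..n}. (net d K\<^sub>0 M\<^sub>0 \<theta>\<^sub>0 (xs i) - f (xs i))\<^sup>2) \<le> 4 * N"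
    and z: "\<And>i. i \<in> {1..n} \<Longrightarrow> \<bar>Y i - f (xs i)\<bar> \<le> 2 * real n"
    and ev1: "\<And>KM. KM \<in> Ms \<Longrightarrow> evidence d xs n f 1 (fst KM) (snd KM) B Y \<le> ennreal (exp (m * N))"
    and ev2: "\<And>KM. KM \<in> Ms \<Longrightarrow> evidence d xs n f (1 / 2) (fst KM) (snd KM) B Y \<le> ennreal (exp (m * N))"
    and l0: "llr n (\<lambda>i. Y i - f (xs i)) (\<lambda>i. - (net d K\<^sub>0 M\<^sub>0 \<theta>\<^sub>0 (xs i) - f (xs i))) \<le> m * N"
    and bad: "\<And>h. P h \<Longrightarrow> a\<^sup>2 * N \<le> (\<Sum>i\<in>{1..n}. (h (xs i) - f (xs i))\<^sup>2)"
  shows "post_mass d xs b0 Ms B n Xi Y P \<le> card Ms * exp (- (m * N)) + 8 * (mass_const b0 m C + m) / a\<^sup>2"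
proof -
  let ?z = "\<lambda>i. Y i - f (xs i)"
  let ?D = "\<lambda>KM. (real (fst KM * snd KM))\<^sup>2 * ln (real n)"
  let ?E = "\<lambda>KM \<Xi>. ELBO d xs n (fst KM) (snd KM) Y \<Xi> (prior_KM d (fst KM) (snd KM) B)"
  have model: "nn_model d (fst KM) (snd KM) n B xs" if "KM \<in> Ms" for KM
    using Ms that d B n xs by unfold_locales auto
  define c where "c = log_norm n ?z"
  let ?g0 = "\<lambda>i. net d K\<^sub>0 M\<^sub>0 \<theta>\<^sub>0 (xs i) - f (xs i)"
  \<comment> \<open>The 8 collects 4 from the squared error in llr(g0) = -llr(-g0) - sq, 3 from the
    perturbation constant and 1/2 from sq/8, using N \<ge> 1; the \<open>4 * C\<close> is the cost
    of the near-optimal architecture.\<close>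
  have lower: "c - (m + 8 + 4 * C) * N \<le> - ?E (K\<^sub>0, M\<^sub>0) (Xi (K\<^sub>0, M\<^sub>0))"
  proof -
    interpret nn_model d K\<^sub>0 M\<^sub>0 n B xs f Y using model[OF K0(1)] by simp
    obtain \<Xi> where \<Xi>: "\<Xi> \<in> Vfam d K\<^sub>0 M\<^sub>0 B"
      "?E (K\<^sub>0, M\<^sub>0) \<Xi> \<le> - c - llr n ?z ?g0 + 3 + sq \<theta>\<^sub>0 / 8 + cost"
      unfolding c_def using ELBO_min_upper[OF th0(1) z] by auto
    have "?E (K\<^sub>0, M\<^sub>0) (Xi (K\<^sub>0, M\<^sub>0)) \<le> ?E (K\<^sub>0, M\<^sub>0) \<Xi>" using Xi[OF K0(1)] \<Xi>(1) by simp
    moreover have "llr n ?z (\<lambda>i. - ?g0 i) = - llr n ?z ?g0 - sq \<theta>\<^sub>0"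
      using llr_scale[of n ?z "- 1" ?g0] by (simp add: llr_def)
    moreover have "C * (real (K\<^sub>0 * M\<^sub>0))\<^sup>2 * ln (real n) \<le> C * (4 * N)"
      unfolding mult.assoc using K0(2) pos by (intro mult_left_mono) auto
    then have "cost \<le> 4 * C * N" using cost[OF K0(1)] by simp
    moreover have "(m + 8 + 4 * C) * N = m * N + 8 * N + 4 * C * N" by (simp add: algebra_simps)
    ultimately show ?thesis using \<Xi>(2) l0 th0(2) pos(5) by linarith
  qed
  have mass: "gamma_hat d xs b0 Ms B n Xi Y KM * measure (Xi KM) S
      \<le> exp (- (m * N)) + gamma_hat d xs b0 Ms B n Xi Y KM * (8 * (mass_const b0 m C + m) / a\<^sup>2)"
    if KM: "KM \<in> Ms" and S: "S = {\<theta> \<in> space (Xi KM). P (net d (fst KM) (snd KM) \<theta>)}" for KM S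
  proof (rule mass_dichotomy)
    interpret nn_model d "fst KM" "snd KM" n B xs f Y by (rule model[OF KM])
    have V: "Xi KM \<in> Vfam d (fst KM) (snd KM) B" using Xi[OF KM] by simp
    show "measure (Xi KM) S \<le> 1" by (rule measure_Vfam_le_1[OF V])
    show "0 \<le> gamma_hat d xs b0 Ms B n Xi Y KM"
      by (rule gamma_hat_nonneg[OF fin _ KM]) (use KM in auto)
    show "- ?E KM (Xi KM) - c \<le> m * N"
      using ELBO_lower[OF V ev1[OF KM]] by (simp add: c_def)
    have "a\<^sup>2 * N \<le> sq \<theta>" if "\<theta> \<in> S" for \<theta>
      by (rule bad) (use that in \<open>simp add: S\<close>)
    then have "- ?E KM (Xi KM) \<le> c + 6 + 2 * cost + 2 * (m * N) - (a\<^sup>2 * N) / 8 * measure (Xi KM) S"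
      unfolding c_def by (intro ELBO_upper_mass[OF V ev2[OF KM]] z)
    then show "- ?E KM (Xi KM) - c \<le> 6 + 2 * (C * ?D KM) + 2 * (m * N) - a\<^sup>2 * N / 8 * measure (Xi KM) S"
      using cost[OF KM] by (simp add: mult.assoc)
    have "gamma_hat d xs b0 Ms B n Xi Y KM \<le> exp (b0 * ((real (fst (K\<^sub>0, M\<^sub>0) * snd (K\<^sub>0, M\<^sub>0)))\<^sup>2
        - (real (fst KM * snd KM))\<^sup>2) * ln (real n) + (- ?E KM (Xi KM) - c) + (m + 8 + 4 * C) * N)"
      by (rule gamma_hat_le[where Xi = Xi, OF fin KM K0(1) _ lower]) simp
    also have "\<dots> \<le> exp (4 * b0 * N - b0 * ?D KM + (- ?E KM (Xi KM) - c) + (m + 8 + 4 * C) * N)"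
      using mult_left_mono[OF K0(2), of b0] pos(1) by (simp add: algebra_simps)
    finally show "gamma_hat d xs b0 Ms B n Xi Y KM
        \<le> exp (4 * b0 * N - b0 * ?D KM + (- ?E KM (Xi KM) - c) + (m + 8 + 4 * C) * N)" .
    show "0 \<le> ?D KM" using n by simp
  qed (use pos in auto)
  have ne: "Ms \<noteq> {}" using K0 by auto
  have "post_mass d xs b0 Ms B n Xi Y P
      \<le> (\<Sum>KM\<in>Ms. exp (- (m * N)) + gamma_hat d xs b0 Ms B n Xi Y KM * (8 * (mass_const b0 m C + m) / a\<^sup>2))"
    unfolding post_mass_def by (intro sum_mono mass) auto
  also have "\<dots> = card Ms * exp (- (m * N)) + 8 * (mass_const b0 m C + m) / a\<^sup>2"
    using sum_gamma_hat[OF fin ne] by (simp add: sum.distrib sum_distrib_right[symmetric] sum_divide_distrib[symmetric])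
  finally show ?thesis .
qed

lemma post_mass_le_1:
  assumes fin: "finite Ms" and Xi: "\<And>KM. KM \<in> Ms \<Longrightarrow> Xi KM \<in> Vfam d (fst KM) (snd KM) B"
  shows "post_mass d xs b0 Ms B n Xi Y P \<le> 1"
proof (cases "Ms = {}")
  case False
  have "post_mass d xs b0 Ms B n Xi Y P \<le> (\<Sum>KM\<in>Ms. gamma_hat d xs b0 Ms B n Xi Y KM * 1)"
    unfolding post_mass_def
    by (intro sum_mono mult_left_mono measure_Vfam_le_1[OF Xi] gamma_hat_nonneg[OF fin False])
  then show ?thesis using sum_gamma_hat[OF fin False] by simp
qed (simp add: post_mass_def)

section \<open>Convergence in outer expectation\<close>

lemma outer_exp_le:
  assumes "u \<in> borel_measurable P" "\<And>y. y \<in> space P \<Longrightarrow> h y \<le> u y"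
  shows "outer_exp P h \<le> (\<integral>\<^sup>+y. u y \<partial>P)"
  unfolding outer_exp_def using assms by (intro INF_lower) auto

text \<open>A sum of all exponential functionals that have to be small: its integral is small, and where it
  is below 1 all stochastic terms are under control. Since the posterior mass is at most 1, no
  measurability of the posterior in the data is needed.\<close>

definition deviation :: "nat \<Rightarrow> (nat \<Rightarrow> nat \<Rightarrow> real) \<Rightarrow> nat \<Rightarrow> ((nat \<Rightarrow> real) \<Rightarrow> real) \<Rightarrow> (nat \<times> nat) set
    \<Rightarrow> real \<Rightarrow> real \<Rightarrow> (nat \<Rightarrow> real) \<Rightarrow> (nat \<Rightarrow> real) \<Rightarrow> ennreal" where
  "deviation d xs n f Ms B t g\<^sub>0 Y =
     (\<Sum>KM\<in>Ms. ennreal (exp (- t)) * evidence d xs n f 1 (fst KM) (snd KM) B Y)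
   + (\<Sum>KM\<in>Ms. ennreal (exp (- t)) * evidence d xs n f (1 / 2) (fst KM) (snd KM) B Y)
   + ennreal (exp (- t)) * ennreal (exp (llr n (\<lambda>i. Y i - f (xs i)) (\<lambda>i. - g\<^sub>0 i)))
   + (\<Sum>i\<in>{1..n}. \<Sum>s\<in>{-1, 1}. ennreal (exp (1 / 2 - 2 * real n))
        * ennreal (exp (llr n (\<lambda>i. Y i - f (xs i)) (\<lambda>j. if j = i then s else 0))))"

lemma borel_measurable_deviation:
  assumes "B > 0"
  shows "deviation d xs n f Ms B t g\<^sub>0 \<in> borel_measurable (Pdata xs n f)"
proof -
  note borel_measurable_evidence[OF assms, measurable]
  show ?thesis unfolding deviation_def by measurable
qed

text \<open>Evidence and exponential likelihood ratios have mean 1, so each summand integrates to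
  its prefactor; \<open>2 * real n\<close> counts coordinates and signs.\<close>

lemma nn_integral_deviation:
  assumes B: "B > 0" and fin: "finite Ms"
  shows "(\<integral>\<^sup>+Y. deviation d xs n f Ms B t g\<^sub>0 Y \<partial>Pdata xs n f)
    = ennreal ((2 * real (card Ms) + 1) * exp (- t) + 2 * real n * exp (1 / 2 - 2 * real n))"
proof -
  note borel_measurable_evidence[OF B, measurable]
  have "(\<integral>\<^sup>+Y. deviation d xs n f Ms B t g\<^sub>0 Y \<partial>Pdata xs n f)
      = (\<Sum>KM\<in>Ms. ennreal (exp (- t))) + (\<Sum>KM\<in>Ms. ennreal (exp (- t))) + ennreal (exp (- t))
        + (\<Sum>i\<in>{1..n}. \<Sum>s\<in>{-1, 1::real}. ennreal (exp (1 / 2 - 2 * real n)))"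
    unfolding deviation_def
    by (simp add: nn_integral_add nn_integral_sum nn_integral_cmult nn_integral_evidence[OF B]
        nn_integral_exp_llr ennreal_plus[symmetric] del: sum_constant ennreal_plus)
  also have "\<dots> = ennreal ((2 * real (card Ms) + 1) * exp (- t) + 2 * real n * exp (1 / 2 - 2 * real n))"
  proof -
    have two: "(\<Sum>s\<in>{-1, 1::real}. ennreal (exp u)) = ennreal (2 * exp u)" for u
      by (simp add: ennreal_mult')
    show ?thesis
      unfolding two
      by (simp add: ennreal_of_nat_eq_real_of_nat ennreal_mult'[symmetric] ennreal_plus[symmetric] algebra_simps del: ennreal_plus)
  qed
  finally show ?thesis .
qed

lemma ennreal_scaled_less_1D:
  assumes "ennreal (exp (- t)) * x < 1"
  shows "x \<le> ennreal (exp t)"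
proof -
  have "x = ennreal (exp t) * (ennreal (exp (- t)) * x)"
    by (simp add: mult.assoc[symmetric] ennreal_mult'[symmetric] mult_exp_exp)
  also have "\<dots> \<le> ennreal (exp t) * 1" using assms by (intro mult_left_mono) auto
  finally show ?thesis by simp
qed

text \<open>If a sum of nonnegative terms is below 1, so is each term: a pointwise form of Markov's
  inequality combined with a union bound.\<close>

lemma deviation_less_1D:
  assumes less: "deviation d xs n f Ms B t g\<^sub>0 Y < 1" and fin: "finite Ms"
  shows "KM \<in> Ms \<Longrightarrow> evidence d xs n f 1 (fst KM) (snd KM) B Y \<le> ennreal (exp t)"
    and "KM \<in> Ms \<Longrightarrow> evidence d xs n f (1 / 2) (fst KM) (snd KM) B Y \<le> ennreal (exp t)"
    and "llr n (\<lambda>i. Y i - f (xs i)) (\<lambda>i. - g\<^sub>0 i) \<le> t"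
    and "i \<in> {1..n} \<Longrightarrow> \<bar>Y i - f (xs i)\<bar> \<le> 2 * real n"
proof -
  let ?z = "\<lambda>i. Y i - f (xs i)"
  let ?e = "\<lambda>c KM. evidence d xs n f c (fst KM) (snd KM) B Y"
  let ?u = "\<lambda>i s. ennreal (exp (1 / 2 - 2 * real n)) * ennreal (exp (llr n ?z (\<lambda>j. if j = i then s else 0)))"
  have part: "(\<Sum>KM\<in>Ms. ennreal (exp (- t)) * ?e 1 KM) < 1" "(\<Sum>KM\<in>Ms. ennreal (exp (- t)) * ?e (1 / 2) KM) < 1"
     "ennreal (exp (- t)) * ennreal (exp (llr n ?z (\<lambda>i. - g\<^sub>0 i))) < 1"
     "(\<Sum>i\<in>{1..n}. \<Sum>s\<in>{-1, 1}. ?u i s) < 1"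
    using less unfolding deviation_def by (auto elim!: le_less_trans[rotated] intro: add_increasing add_increasing2)
  have member: "g x < 1" if "(\<Sum>x\<in>A. g x) < 1" "finite A" "x \<in> A" for g :: "'z \<Rightarrow> ennreal" and A x
    using member_le_sum[of x A g] that by (auto intro: le_less_trans)
  show "?e 1 KM \<le> ennreal (exp t)" if "KM \<in> Ms"
    by (rule ennreal_scaled_less_1D) (rule member[OF part(1) fin that])
  show "?e (1 / 2) KM \<le> ennreal (exp t)" if "KM \<in> Ms"
    by (rule ennreal_scaled_less_1D) (rule member[OF part(2) fin that])
  show "llr n ?z (\<lambda>i. - g\<^sub>0 i) \<le> t"
    using ennreal_scaled_less_1D[OF part(3)] by simp
  show "\<bar>?z i\<bar> \<le> 2 * real n" if i: "i \<in> {1..n}"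
  proof -
    \<comment> \<open>Chernoff bound in the direction \<open>s\<close> times the i-th unit vector,
      where the log-likelihood ratio is s z_i - 1/2; this is the source of the 1/2 in the
      prefactor.\<close>
    have "s * ?z i \<le> 2 * real n" if s: "s \<in> {-1, 1}" for s :: real
    proof -
      have "?u i s < 1" by (rule member[OF member[OF part(4) _ i] _ s]) auto
      then have "ennreal (exp (- (2 * real n - 1 / 2))) * ennreal (exp (llr n ?z (\<lambda>j. if j = i then s else 0))) < 1"
        by simp
      then have "llr n ?z (\<lambda>j. if j = i then s else 0) \<le> 2 * real n - 1 / 2"
        using ennreal_scaled_less_1D by fastforce
      moreover have "llr n ?z (\<lambda>j. if j = i then s else 0) = s * ?z i - s\<^sup>2 / 2"
        using i by (simp add: llr_def if_distrib[of "\<lambda>x. _ * x"] if_distrib[of "\<lambda>x. x\<^sup>2"] cong: if_cong)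
      ultimately show ?thesis using s by auto
    qed
    from this[of 1] this[of "-1"] show ?thesis by (simp add: abs_le_iff)
  qed
qed

section \<open>The rate and near-optimal networks\<close>

lemma supnorm_ge: "x \<in> cube d \<Longrightarrow> ereal \<bar>h x\<bar> \<le> supnorm d h"
  unfolding supnorm_def by (rule SUP_upper)

lemma supnorm_nonneg: "0 \<le> supnorm d h"
proof -
  have "(\<lambda>_. 0) \<in> cube d" by (simp add: cube_def)
  then have "ereal \<bar>h (\<lambda>_. 0)\<bar> \<le> supnorm d h" by (rule supnorm_ge)
  then show ?thesis by (rule order_trans[rotated]) simp
qed

text \<open>K \<ge> 2 and M \<ge> 1 give K M \<ge> 2. Hence n eps_n^2 \<ge> 4 log n, which lets the
  exponential bounds beat polynomially many architectures. Membership of \<open>f\<close> keeps the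
  supremum over the class from being minus infinity.\<close>

lemma eps_n_ge:
  assumes "f \<in> Fs" "Ms \<subseteq> {KM. fst KM \<ge> 2 \<and> snd KM \<ge> 1}" "n \<ge> 2"
  shows "ereal (2 * sqrt (ln (real n) / real n)) \<le> eps_n d Ms B Fs n"
  unfolding eps_n_def
proof (rule INF_greatest)
  fix KM assume "KM \<in> Ms"
  then have "2 * 1 \<le> fst KM * snd KM" using assms(2) by (intro mult_le_mono) auto
  then have "2 \<le> real (fst KM * snd KM)" by linarith
  then have "2 * sqrt (ln (real n) / real n) \<le> real (fst KM * snd KM) * sqrt (ln (real n) / real n)"
    using assms(3) by (intro mult_right_mono) auto
  moreover have "0 \<le> (SUP f\<in>Fs. INF \<theta>\<in>ThetaB d (fst KM) (snd KM) B. supnorm d (\<lambda>x. net d (fst KM) (snd KM) \<theta> x - f x))"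
    using assms(1) by (intro SUP_upper2[of f] INF_greatest supnorm_nonneg)
  ultimately show "ereal (2 * sqrt (ln (real n) / real n)) \<le> (SUP f\<in>Fs. INF \<theta>\<in>ThetaB d (fst KM) (snd KM) B.
      supnorm d (\<lambda>x. net d (fst KM) (snd KM) \<theta> x - f x)) + ereal (real (fst KM * snd KM) * sqrt (ln (real n) / real n))"
    by (intro add_increasing) simp_all
qed

text \<open>The infima need not be attained, so \<open>e\<close> lies strictly above the rate. Both
  summands of the rate are nonnegative, hence each is below \<open>e\<close>; the sup norm controls
  the error at the inputs.\<close>

lemma eps_n_near_optimal:
  assumes f: "f \<in> Fs" and n: "n \<ge> 2" and less: "eps_n d Ms B Fs n < ereal e" and xs: "\<And>i. xs i \<in> cube d"
  obtains K M \<theta> where "(K, M) \<in> Ms" "\<forall>j<pdim d K M. \<bar>\<theta> j\<bar> \<le> B"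
    "(real (K * M))\<^sup>2 * ln (real n) \<le> real n * e\<^sup>2"
    "(\<Sum>i\<in>{1..n}. (net d K M \<theta> (xs i) - f (xs i))\<^sup>2) \<le> real n * e\<^sup>2"
proof -
  let ?S = "\<lambda>K M f. INF \<theta>\<in>ThetaB d K M B. supnorm d (\<lambda>x. net d K M \<theta> x - f x)"
  let ?r = "sqrt (ln (real n) / real n)"
  obtain K M where KM: "(K, M) \<in> Ms" and lt: "(SUP f\<in>Fs. ?S K M f) + ereal (real (K * M) * ?r) < ereal e"
    using less unfolding eps_n_def INF_less_iff by auto
  have S0: "0 \<le> ?S K M f" by (intro INF_greatest supnorm_nonneg)
  also have S: "?S K M f \<le> (SUP f\<in>Fs. ?S K M f)" using f by (rule SUP_upper)
  finally have SUP0: "0 \<le> (SUP f\<in>Fs. ?S K M f)" .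
  have r0: "0 \<le> real (K * M) * ?r" using n by simp
  have "ereal (real (K * M) * ?r) \<le> (SUP f\<in>Fs. ?S K M f) + ereal (real (K * M) * ?r)"
    using SUP0 by (intro add_increasing) auto
  with lt have r: "real (K * M) * ?r < e" using order_le_less_trans by fastforce
  have "(SUP f\<in>Fs. ?S K M f) \<le> (SUP f\<in>Fs. ?S K M f) + ereal (real (K * M) * ?r)"
    using r0 by (intro add_increasing2) auto
  with lt S have "?S K M f < ereal e" by order
  then obtain \<theta> where th: "\<theta> \<in> ThetaB d K M B" and sup: "supnorm d (\<lambda>x. net d K M \<theta> x - f x) < ereal e"
    unfolding INF_less_iff by auto
  show thesis
  proof (rule that[OF KM])
    show "\<forall>j<pdim d K M. \<bar>\<theta> j\<bar> \<le> B" using th by (force simp: ThetaB_def PiE_def Pi_def abs_le_iff)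
    have "(real (K * M) * ?r)\<^sup>2 \<le> e\<^sup>2" using r r0 by (intro power_mono) auto
    then show "(real (K * M))\<^sup>2 * ln (real n) \<le> real n * e\<^sup>2"
      using n by (simp add: power_mult_distrib field_simps)
    have "(net d K M \<theta> (xs i) - f (xs i))\<^sup>2 \<le> e\<^sup>2" for i
    proof -
      have "ereal \<bar>net d K M \<theta> (xs i) - f (xs i)\<bar> \<le> supnorm d (\<lambda>x. net d K M \<theta> x - f x)"
        using xs by (intro supnorm_ge)
      then have "\<bar>net d K M \<theta> (xs i) - f (xs i)\<bar> < e" using sup order_le_less_trans by fastforce
      then show ?thesis by (simp add: abs_le_square_iff[symmetric])
    qed
    then have "(\<Sum>i\<in>{1..n}. (net d K M \<theta> (xs i) - f (xs i))\<^sup>2) \<le> (\<Sum>i\<in>{1..n}. e\<^sup>2)" by (intro sum_mono)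
    then show "(\<Sum>i\<in>{1..n}. (net d K M \<theta> (xs i) - f (xs i))\<^sup>2) \<le> real n * e\<^sup>2" by simp
  qed
qed

text \<open>A bound at fixed \<open>n\<close> whose right-hand side does not involve
  \<open>f\<close>, so it passes to the supremum over the class.\<close>

lemma outer_exp_post_mass_le:
  fixes f :: "(nat \<Rightarrow> real) \<Rightarrow> real" and Xi :: "(nat \<Rightarrow> real) \<Rightarrow> nat \<times> nat \<Rightarrow> (nat \<Rightarrow> real) measure"
  assumes fin: "finite Ms" and Ms: "Ms \<subseteq> {KM. fst KM \<ge> 2 \<and> snd KM \<ge> 1}"
    and d: "d \<ge> 1" and B: "B \<ge> 1" and n: "n \<ge> 2" and xs: "\<And>i. xs i \<in> cube d" and f: "f \<in> Fs"
    and Xi: "\<And>Y KM. KM \<in> Ms \<Longrightarrow> Xi Y KM \<in> Vfam d (fst KM) (snd KM) B \<and>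
          (\<forall>\<Xi>\<in>Vfam d (fst KM) (snd KM) B.
             ELBO d xs n (fst KM) (snd KM) Y (Xi Y KM) (prior_KM d (fst KM) (snd KM) B)
             \<le> ELBO d xs n (fst KM) (snd KM) Y \<Xi> (prior_KM d (fst KM) (snd KM) B))"
    and cost: "\<And>KM. KM \<in> Ms \<Longrightarrow> nn_model.cost d (fst KM) (snd KM) n B
          \<le> C * (real (fst KM * snd KM))\<^sup>2 * ln (real n)"
    and pos: "b0 > 0" "C \<ge> 0" "a > 0" "m \<ge> 0"
  shows "outer_exp (Pdata xs n f) (\<lambda>Y. ennreal (post_mass d xs b0 Ms B n (Xi Y) Y
           (\<lambda>h. ereal (empnorm xs n (\<lambda>x. h x - f x)) \<ge> ereal a * eps_n d Ms B Fs n)))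
    \<le> ennreal ((3 * real (card Ms) + 1) * real n powr (- 4 * m) + 2 * real n * exp (1 / 2 - 2 * real n)
        + 8 * (mass_const b0 m C + m) / a\<^sup>2)"
    (is "outer_exp _ (\<lambda>Y. ennreal (post_mass _ _ _ _ _ _ _ _ ?P)) \<le> ennreal ?bound")
proof (cases "eps_n d Ms B Fs n")
  case PInf
  \<comment> \<open>With an infinite rate and \<open>a > 0\<close> the threshold is infinite, while
    the empirical norm is a real number.\<close>
  then have "\<not> ?P h" for h using pos by simp
  then have "post_mass d xs b0 Ms B n (Xi Y) Y ?P = 0" for Y by (simp add: post_mass_def)
  then have "outer_exp (Pdata xs n f) (\<lambda>Y. ennreal (post_mass d xs b0 Ms B n (Xi Y) Y ?P)) \<le> (\<integral>\<^sup>+Y. 0 \<partial>Pdata xs n f)"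
    by (intro outer_exp_le) auto
  then show ?thesis by simp
next
  case MInf
  then show ?thesis using eps_n_ge[OF f Ms n, of d B] by simp
next
  case (real e)
  have e: "2 * sqrt (ln (real n) / real n) \<le> e" using eps_n_ge[OF f Ms n, of d B] real by simp
  have "0 < sqrt (ln (real n) / real n)" using n by simp
  then have e0: "e > 0" using e by linarith
  define N where "N = real n * e\<^sup>2"
  have "(2 * sqrt (ln (real n) / real n))\<^sup>2 \<le> e\<^sup>2" using e n by (intro power_mono) auto
  then have N: "4 * ln (real n) \<le> N" using n by (simp add: N_def power_mult_distrib field_simps)
  have "ln 2 \<le> ln (real n)" using n by simp
  then have N1: "1 \<le> N" using N ln2_ge_two_thirds by linarith
  \<comment> \<open>Doubling \<open>e\<close> gives the strict inequality and turns \<open>N\<close>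
    into \<open>4 * N\<close> for the near-optimal network.\<close>
  have lt: "eps_n d Ms B Fs n < ereal (2 * e)" using real e0 by simp
  have N4: "real n * (2 * e)\<^sup>2 = 4 * N" by (simp add: N_def power_mult_distrib)
  obtain K M \<theta> where KM: "(K, M) \<in> Ms"
    and th: "\<forall>j<pdim d K M. \<bar>\<theta> j\<bar> \<le> B"
    and K: "(real (K * M))\<^sup>2 * ln (real n) \<le> 4 * N"
    and sq: "(\<Sum>i\<in>{1..n}. (net d K M \<theta> (xs i) - f (xs i))\<^sup>2) \<le> 4 * N"
    by (rule eps_n_near_optimal[where xs = xs, OF f n lt xs, unfolded N4])
  define g\<^sub>0 where "g\<^sub>0 i = net d K M \<theta> (xs i) - f (xs i)" for i
  define r where "r = card Ms * exp (- (m * N)) + 8 * (mass_const b0 m C + m) / a\<^sup>2"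
  let ?U = "deviation d xs n f Ms B (m * N) g\<^sub>0"
  have mc: "0 \<le> mass_const b0 m C" unfolding mass_const_def using pos
    by (intro add_nonneg_nonneg mult_nonneg_nonneg divide_nonneg_nonneg) auto
  then have r0: "0 \<le> r" unfolding r_def using pos by auto
  have bound: "ennreal (post_mass d xs b0 Ms B n (Xi Y) Y ?P) \<le> ennreal r + ?U Y" for Y
  proof (cases "?U Y < 1")
    case True
    note good = deviation_less_1D[OF True fin]
    have "post_mass d xs b0 Ms B n (Xi Y) Y ?P \<le> r"
      unfolding r_def
    proof (rule post_mass_le[OF fin Ms d B n xs Xi cost pos N1 KM K th sq good(4,1,2)])
      show "llr n (\<lambda>i. Y i - f (xs i)) (\<lambda>i. - (net d K M \<theta> (xs i) - f (xs i))) \<le> m * N"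
        using good(3) by (simp add: g\<^sub>0_def)
      fix h assume "?P h"
      then have "a * e \<le> empnorm xs n (\<lambda>x. h x - f x)" using real by simp
      then have "(a * e)\<^sup>2 \<le> (empnorm xs n (\<lambda>x. h x - f x))\<^sup>2" using pos e0 by (intro power_mono) auto
      also have "\<dots> = (1 / real n) * (\<Sum>i\<in>{1..n}. (h (xs i) - f (xs i))\<^sup>2)"
        unfolding empnorm_def by (intro real_sqrt_pow2 mult_nonneg_nonneg sum_nonneg) auto
      finally show "a\<^sup>2 * N \<le> (\<Sum>i\<in>{1..n}. (h (xs i) - f (xs i))\<^sup>2)"
        using n by (simp add: N_def power_mult_distrib field_simps)
    qed
    then have "ennreal (post_mass d xs b0 Ms B n (Xi Y) Y ?P) \<le> ennreal r" by (rule ennreal_leI)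
    then show ?thesis by (rule add_increasing2[rotated]) simp
  next
    case False
    have "post_mass d xs b0 Ms B n (Xi Y) Y ?P \<le> 1"
      using Xi by (intro post_mass_le_1[OF fin]) blast
    then have "ennreal (post_mass d xs b0 Ms B n (Xi Y) Y ?P) \<le> 1" by simp
    also have "1 \<le> ?U Y" using False by simp
    finally show ?thesis by (rule add_increasing[rotated]) simp
  qed
  have B0: "B > 0" using B by simp
  interpret prob_space "Pdata xs n f" by (rule prob_space_Pdata)
  note borel_measurable_deviation[OF B0, measurable]
  have "outer_exp (Pdata xs n f) (\<lambda>Y. ennreal (post_mass d xs b0 Ms B n (Xi Y) Y ?P))
      \<le> (\<integral>\<^sup>+Y. ennreal r + ?U Y \<partial>Pdata xs n f)"
    using bound by (intro outer_exp_le) auto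
  also have "\<dots> = ennreal r + ennreal ((2 * real (card Ms) + 1) * exp (- (m * N)) + 2 * real n * exp (1 / 2 - 2 * real n))"
    using nn_integral_deviation[OF B0 fin, where d = d and xs = xs and n = n and f = f and t = "m * N" and g\<^sub>0 = g\<^sub>0]
    by (simp add: nn_integral_add emeasure_space_1)
  also have "\<dots> = ennreal ((3 * real (card Ms) + 1) * exp (- (m * N)) + 2 * real n * exp (1 / 2 - 2 * real n)
        + 8 * (mass_const b0 m C + m) / a\<^sup>2)"
    using r0 by (subst ennreal_plus[symmetric]) (auto simp: r_def algebra_simps)
  also have "\<dots> \<le> ennreal ?bound"
  proof (intro ennreal_leI add_mono mult_left_mono order_refl)
    have "m * (4 * ln (real n)) \<le> m * N" using N pos by (intro mult_left_mono)
    then show "exp (- (m * N)) \<le> real n powr (- 4 * m)" using n by (simp add: powr_def mult_ac)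
  qed simp_all
  finally show ?thesis .
qed

theorem theorem4p2:
  fixes d :: nat
    and xs :: "nat \<Rightarrow> (nat \<Rightarrow> real)"
    and Fs :: "((nat \<Rightarrow> real) \<Rightarrow> real) set"
    and Ms :: "nat \<Rightarrow> (nat \<times> nat) set"
    and B :: "nat \<Rightarrow> real"
    and b0 :: real
    and Xi_hat :: "nat \<Rightarrow> (nat \<Rightarrow> real) \<Rightarrow> nat \<times> nat \<Rightarrow> (nat \<Rightarrow> real) measure"
    and A :: "nat \<Rightarrow> real"
  assumes d_pos: "d \<ge> 1"
    and xs_cube: "\<And>i. xs i \<in> cube d"
    and Fs_meas: "\<And>f. f \<in> Fs \<Longrightarrow>
          f \<in> borel_measurable (restrict_space (PiM {..<d} (\<lambda>_. lborel)) (cube d))"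
    and Ms_sub: "\<And>n. Ms n \<subseteq> {KM. fst KM \<ge> 2 \<and> snd KM \<ge> 1}"
    and Ms_card: "\<exists>C \<iota>. \<iota> > 0 \<and> (\<forall>n\<ge>1. finite (Ms n) \<and> real (card (Ms n)) \<le> C * real n powr \<iota>)"
    and Ms_size: "\<exists>C. \<forall>n\<ge>1. \<forall>KM\<in>Ms n. real (max (fst KM) (snd KM)) \<le> C * real n"
    and B_bounds: "\<exists>C \<nu>. \<nu> > 0 \<and> (\<forall>n\<ge>1. 1 \<le> B n \<and> B n \<le> C * real n powr \<nu>)"
    and b0_pos: "b0 > 0"
    and Xi_hat_argmin: "\<And>n Y KM. KM \<in> Ms n \<Longrightarrow>
          Xi_hat n Y KM \<in> Vfam d (fst KM) (snd KM) (B n) \<and>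
          (\<forall>Xi\<in>Vfam d (fst KM) (snd KM) (B n).
             ELBO d xs n (fst KM) (snd KM) Y (Xi_hat n Y KM) (prior_KM d (fst KM) (snd KM) (B n))
             \<le> ELBO d xs n (fst KM) (snd KM) Y Xi (prior_KM d (fst KM) (snd KM) (B n)))"
    and A_inf: "filterlim A at_top sequentially"
  shows "(\<lambda>n. SUP f\<in>Fs. outer_exp (Pdata xs n f)
            (\<lambda>Y. ennreal (post_mass d xs b0 (Ms n) (B n) n (Xi_hat n Y) Y
                   (\<lambda>g. ereal (empnorm xs n (\<lambda>x. g x - f x))
                        \<ge> ereal (A n) * eps_n d (Ms n) (B n) Fs n))))
         \<longlonglongrightarrow> 0"
proof -
  obtain C\<^sub>M \<iota> where io: "\<iota> > 0"
    and card: "\<And>n. n \<ge> 1 \<Longrightarrow> finite (Ms n) \<and> real (card (Ms n)) \<le> C\<^sub>M * real n powr \<iota>"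
    using Ms_card by blast
  obtain C\<^sub>S where size: "\<And>n KM. n \<ge> 1 \<Longrightarrow> KM \<in> Ms n \<Longrightarrow> real (max (fst KM) (snd KM)) \<le> C\<^sub>S * real n"
    using Ms_size by blast
  obtain C\<^sub>B \<nu> where nu: "\<nu> > 0" and Bb: "\<And>n. n \<ge> 1 \<Longrightarrow> 1 \<le> B n \<and> B n \<le> C\<^sub>B * real n powr \<nu>"
    using B_bounds by blast
  define C where "C = cost_const d C\<^sub>B \<nu> C\<^sub>S"
  \<comment> \<open>The free parameter \<open>m\<close> is set to \<open>\<iota>\<close>: the
    exponential terms are at most n^(-4 \<iota>), and the number of architectures costs a factor of
    order n^\<iota>.\<close>
  define c where "c = 8 * (mass_const b0 \<iota> C + \<iota>)"
  define R where "R n = 3 * C\<^sub>M * real n powr (- 3 * \<iota>) + real n powr (- 4 * \<iota>)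
      + 2 * real n * exp (1 / 2 - 2 * real n) + c / (A n)\<^sup>2" for n
  let ?X = "\<lambda>n. SUP f\<in>Fs. outer_exp (Pdata xs n f)
            (\<lambda>Y. ennreal (post_mass d xs b0 (Ms n) (B n) n (Xi_hat n Y) Y
                   (\<lambda>g. ereal (empnorm xs n (\<lambda>x. g x - f x))
                        \<ge> ereal (A n) * eps_n d (Ms n) (B n) Fs n)))"
  have C0: "C \<ge> 0" unfolding C_def using d_pos nu by (intro cost_const_nonneg) auto
  \<comment> \<open>The bound at fixed \<open>n\<close> requires n \<ge> 2 and a positive
    \<open>A n\<close>; both hold eventually.\<close>
  have "\<forall>\<^sub>F n in sequentially. n \<ge> 2 \<and> A n > 0"
    using eventually_ge_at_top[of 2] filterlim_at_top_dense[THEN iffD1, OF A_inf, rule_format, of 0]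
    by eventually_elim simp
  then have upper: "\<forall>\<^sub>F n in sequentially. ?X n \<le> ennreal (R n)"
  proof eventually_elim
    case (elim n)
    then have n1: "n \<ge> 1" by simp
    have cost: "nn_model.cost d (fst KM) (snd KM) n (B n) \<le> C * (real (fst KM * snd KM))\<^sup>2 * ln (real n)"
      if "KM \<in> Ms n" for KM
    proof -
      interpret nn_model d "fst KM" "snd KM" n "B n" xs
        using Ms_sub[of n] that d_pos Bb[OF n1] elim xs_cube by unfold_locales auto
      show ?thesis
        unfolding C_def using size[OF n1 that] Bb[OF n1] nu by (intro cost_le) auto
    qed
    have le: "(3 * real (card (Ms n)) + 1) * real n powr (- 4 * \<iota>) + 2 * real n * exp (1 / 2 - 2 * real n)
        + 8 * (mass_const b0 \<iota> C + \<iota>) / (A n)\<^sup>2 \<le> R n"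
    proof -
      have "3 * real (card (Ms n)) * real n powr (- 4 * \<iota>) \<le> 3 * (C\<^sub>M * real n powr \<iota>) * real n powr (- 4 * \<iota>)"
        using card[OF n1] by (intro mult_right_mono mult_left_mono) auto
      also have "\<dots> = 3 * C\<^sub>M * real n powr (- 3 * \<iota>)"
        using elim by (simp add: powr_add[symmetric])
      finally show ?thesis unfolding R_def c_def by (simp add: algebra_simps)
    qed
    show ?case
    proof (rule SUP_least)
      fix f assume f: "f \<in> Fs"
      show "outer_exp (Pdata xs n f) (\<lambda>Y. ennreal (post_mass d xs b0 (Ms n) (B n) n (Xi_hat n Y) Y
                   (\<lambda>g. ereal (empnorm xs n (\<lambda>x. g x - f x))
                        \<ge> ereal (A n) * eps_n d (Ms n) (B n) Fs n))) \<le> ennreal (R n)"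
        using card[OF n1] Bb[OF n1] elim io C0 b0_pos
        by (intro order_trans[OF outer_exp_post_mass_le[OF _ Ms_sub d_pos _ _ xs_cube f Xi_hat_argmin cost]
              ennreal_leI[OF le]]) auto
    qed
  qed
  have "R \<longlonglongrightarrow> 0"
  proof -
    have 1: "(\<lambda>n. real n powr (- 3 * \<iota>)) \<longlonglongrightarrow> 0" "(\<lambda>n. real n powr (- 4 * \<iota>)) \<longlonglongrightarrow> 0"
      using io by (intro tendsto_neg_powr filterlim_real_sequentially; simp)+
    have 2: "(\<lambda>n. 2 * real n * exp (1 / 2 - 2 * real n)) \<longlonglongrightarrow> 0" by real_asymp
    have "filterlim (\<lambda>n. (A n)\<^sup>2) at_top sequentially"
      using A_inf by (intro filterlim_pow_at_top) auto
    then have 3: "(\<lambda>n. c / (A n)\<^sup>2) \<longlonglongrightarrow> 0"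
      by (intro real_tendsto_divide_at_top[OF tendsto_const])
    have "R \<longlonglongrightarrow> 3 * C\<^sub>M * 0 + 0 + 0 + 0"
      unfolding R_def by (intro tendsto_add tendsto_mult_left 1 2 3)
    then show ?thesis by simp
  qed
  then have "(\<lambda>n. ennreal (R n)) \<longlonglongrightarrow> 0" using tendsto_ennrealI by fastforce
  then show ?thesis
    by (rule tendsto_sandwich[OF _ upper tendsto_const, rotated]) simp
qed

end
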